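(* Let $\lambda\in k$ with $\lambda\neq0$. (i) Let $(A,\ast,\circ,\Delta_r,\delta_r)$ be a factorizable anti-pre-Poisson bialgebra with $r\in A\otimes A$. Then $(A,\ast,\circ,P,\omega)$ is a quadratic Rota-Baxter anti-pre-Poisson algebra of weight $\lambda$, where $\omega(x,y)=-\lambda\langle T_{r+\tau(r)}^{-1}(x),y\rangle$ for all $x,y\in A$ and $P(x)=T_r\omega^\sharp(x)$ for all $x\in A$. (ii) Conversely, let $(A,\ast,\circ,P,\omega)$ be a quadratic Rota-Baxter anti-pre-Poisson algebra of weight $\lambda$. Then there is a factorizable anti-pre-Poisson bialgebra $(A,\ast,\circ,\Delta_r,\delta_r)$, where $r\in A\otimes A$ is given through the operator form $T_r=P(\omega^\sharp)^{-1}$. Here $\Delta_r(x)=-(I\otimes L_\star(x)+L_\ast(x)\otimes I)r$ and $\delta_r(x)=(L_\circ(x)\otimes I-I\otimes\mathrm{ad}(x))r$ for all $x\in A$.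
   Context: Throughout, $k$ is a field and all vector spaces and algebras are finite-dimensional over $k$. Algebras. An anti-Zinbiel algebra $(A,\ast)$ is a vector space with a bilinear operation such that $x\ast(y\ast z)=-(x\ast y+y\ast x)\ast z=-(y\ast z+z\ast y)\ast x=z\ast(y\ast x)$ and $z\ast(x\ast y)=x\ast(z\ast y)$ for all $x,y,z$. An anti-pre-Lie algebra $(A,\circ)$ is a vector space with a bilinear operation such that, with $[x,y]=x\circ y-y\circ x$, $x\circ(y\circ z)-y\circ(x\circ z)=[y,x]\circ z$ and $[x,y]\circ z+[y,z]\circ x+[z,x]\circ y=0$. An anti-pre-Poisson algebra $(A,\ast,\circ)$ consists of an anti-Zinbiel algebra $(A,\ast)$ and an anti-pre-Lie algebra $(A,\circ)$ with $(x\circ y-y\circ x)\ast z=y\ast(x\circ z)-x\circ(y\ast z)$, $(x\ast y+y\ast x)\circ z=-x\ast(y\circ z)-y\ast(x\circ z)$, and $z\circ(x\ast y+y\ast x)+x\ast(y\circ z)+y\ast(x\circ z)=x\ast(z\circ y)+y\ast(z\circ x)$. Put $x\star y=x\ast y+y\ast x$. Operators. $L_\ast(x)y=x\ast y$, $R_\ast(x)y=y\ast x$ (similarly for other operations), $\mathrm{ad}(x)=L_\circ(x)-R_\circ(x)$, $L_\star=L_\ast+R_\ast$. $\tau(x\otimes y)=y\otimes x$; $I$ is the identity. For $s\in A\otimes A$, $T_s:A^*\to A$ is given by $\langle T_s(\zeta),\eta\rangle=\langle s,\zeta\otimes\eta\rangle$. For a non-degenerate bilinear form $\omega$ on $A$,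 $\omega^\sharp:A\to A^*$ is the isomorphism $\langle\omega^\sharp(x),y\rangle=\omega(x,y)$. Quadratic Rota-Baxter anti-pre-Poisson algebra $(A,\ast,\circ,P,\omega)$ of weight $\lambda$: $(A,\ast,\circ)$ is an anti-pre-Poisson algebra; $\omega$ is a non-degenerate symmetric bilinear form with $\omega(x\ast y,z)=-\omega(y,x\star z)$ and $\omega(x\circ y,z)=\omega(y,[x,z])$ (i.e. $(A,\ast,\circ,\omega)$ is a quadratic anti-pre-Poisson algebra); $P:A\to A$ is linear with $P(x)\ast P(y)=P(P(x)\ast y+x\ast P(y)+\lambda x\ast y)$ and $P(x)\circ P(y)=P(P(x)\circ y+x\circ P(y)+\lambda x\circ y)$; and $\omega(P(x),y)+\omega(x,P(y))+\lambda\omega(x,y)=0$, for all $x,y,z\in A$. Quasi-triangular and factorizable. $r=\sum_ia_i\otimes b_i\in A\otimes A$ solves the APP-YBE if $D(r)=\sum_{i,j}\big(a_i\otimes b_i\ast a_j\otimes b_j-a_i\ast a_j\otimes b_i\otimes b_j+a_i\otimes a_j\otimes b_i\star b_j\big)=0$ and $S(r)=\sum_{i,j}\big(a_i\circ a_j\otimes b_i\otimes b_j+a_i\otimes b_i\circ a_j\otimes b_j-a_i\otimes a_j\otimes[b_i,b_j]\big)=0$. An element $s\in A\otimes A$ is invariant if $(I\otimes L_\star(x)+L_\ast(x)\otimes I)s=0$ and $(L_\circ(x)\otimes I-I\otimes\mathrm{ad}(x))s=0$ for all $x\in A$. If $r$ solves the APP-YBE and $r+\tau(r)$ is invariant, the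 anti-pre-Poisson bialgebra $(A,\ast,\circ,\Delta_r,\delta_r)$ is called quasi-triangular; it is factorizable if moreover $T_{r+\tau(r)}:A^*\to A$ is a linear isomorphism. Anti-pre-Poisson bialgebra $(A,\ast,\circ,\Delta,\delta)$: $(A,\ast,\circ)$ is an anti-pre-Poisson algebra; $(A,\Delta,\delta)$ is an anti-pre-Poisson coalgebra, i.e. (equivalently) the operations on $A^*$ dual to $\Delta$ and $\delta$ make $A^*$ an anti-pre-Poisson algebra; and for all $x,y\in A$: (1) $\Delta(x\star y)=(I\otimes L_\star(x))\Delta(y)-(L_\ast(y)\otimes I)\Delta(x)$; (2) $(\Delta+\tau\Delta)(x\ast y)=(L_\ast(x)\otimes I)(\Delta+\tau\Delta)(y)-(I\otimes R_\ast(y))\Delta(x)$; (3) $\delta([x,y])=(I\otimes\mathrm{ad}(x)-L_\circ(x)\otimes I)\delta(y)-(I\otimes\mathrm{ad}(y)-L_\circ(y)\otimes I)\delta(x)$; (4) $(I\otimes I-\tau)\big(\delta(x\circ y)-(L_\circ(x)\otimes I)\delta(y)-(I\otimes L_\circ(x))\delta(y)+(I\otimes R_\circ(y))\delta(x)\big)=0$; (5) $\delta(x\star y)=(I\otimes L_\star(x))\delta(y)+(I\otimes L_\star(y))\delta(x)+(L_\circ(x)\otimes I)\Delta(y)+(L_\circ(y)\otimes I)\Delta(x)$; (6) $\Delta([x,y])=-(L_\circ(x)\otimes I)\Delta(y)-(I\otimes L_\star(y))\delta(x)-(L_\ast(y)\otimes I)\delta(x)+(I\otimes\mathrm{ad}(x))\Delta(y)$;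 (7) $(\Delta+\tau\Delta)(x\circ y)=(I\otimes I+\tau)\big((L_\circ(x)\otimes I)\Delta(y)+(I\otimes L_\circ(x))\Delta(y)+(I\otimes R_\ast(y))\delta(x)\big)$; (8) $\delta(x\ast y)-\tau\delta(x\ast y)=(I\otimes L_\ast(x))\delta(y)-\tau(L_\ast(x)\otimes I)\delta(y)-(L_\circ(x)\otimes I)\Delta(y)-\tau(I\otimes L_\circ(x))\Delta(y)-(I\otimes R_\ast(y))\delta(x)-\tau(I\otimes R_\circ(y))\Delta(x)$. *)

theory Defs
  imports Complex_Main "HOL-Library.Function_Algebras"
begin

section \<open>Algebras\<close>

text \<open>
  The algebras are based on a carrier \<open>V\<close>, a subspace of the ambient vector space given by the scalar
  multiplication \<open>scl\<close>: the algebra \<open>A\<close> itself is a whole type (\<open>V = UNIV\<close>), while its dual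
  is a subspace of a function space.
\<close>

definition vector_space_on :: "('k::field \<Rightarrow> 'v::ab_group_add \<Rightarrow> 'v) \<Rightarrow> 'v set \<Rightarrow> bool" where
  "vector_space_on scl V \<longleftrightarrow> vector_space scl \<and> module.subspace scl V"

definition bilinear_op_on ::
  "('k::field \<Rightarrow> 'v::ab_group_add \<Rightarrow> 'v) \<Rightarrow> 'v set \<Rightarrow> ('v \<Rightarrow> 'v \<Rightarrow> 'v) \<Rightarrow> bool" where
  "bilinear_op_on scl V m \<longleftrightarrow>
     (\<forall>x\<in>V. \<forall>y\<in>V. m x y \<in> V) \<and>
     (\<forall>x\<in>V. \<forall>y\<in>V. \<forall>z\<in>V. m (x + y) z = m x z + m y z \<and> m x (y + z) = m x y + m x z) \<and>
     (\<forall>c. \<forall>x\<in>V. \<forall>y\<in>V. m (scl c x) y = scl c (m x y) \<and> m x (scl c y) = scl c (m x y))"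

definition star :: "('v \<Rightarrow> 'v \<Rightarrow> 'v) \<Rightarrow> 'v \<Rightarrow> 'v \<Rightarrow> 'v::ab_group_add" where
  "star ast x y = ast x y + ast y x"

definition bracket :: "('v \<Rightarrow> 'v \<Rightarrow> 'v) \<Rightarrow> 'v \<Rightarrow> 'v \<Rightarrow> 'v::ab_group_add" where
  "bracket circ x y = circ x y - circ y x"

definition anti_Zinbiel_on ::
  "('k::field \<Rightarrow> 'v::ab_group_add \<Rightarrow> 'v) \<Rightarrow> 'v set \<Rightarrow> ('v \<Rightarrow> 'v \<Rightarrow> 'v) \<Rightarrow> bool" where
  "anti_Zinbiel_on scl V ast \<longleftrightarrow>
     vector_space_on scl V \<and> bilinear_op_on scl V ast \<and>
     (\<forall>x\<in>V. \<forall>y\<in>V. \<forall>z\<in>V.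
        ast x (ast y z) = - ast (ast x y + ast y x) z \<and>
        - ast (ast x y + ast y x) z = - ast (ast z y + ast y z) x \<and>
        - ast (ast z y + ast y z) x = ast z (ast y x) \<and>
        ast z (ast x y) = ast x (ast z y))"

definition anti_pre_Lie_on ::
  "('k::field \<Rightarrow> 'v::ab_group_add \<Rightarrow> 'v) \<Rightarrow> 'v set \<Rightarrow> ('v \<Rightarrow> 'v \<Rightarrow> 'v) \<Rightarrow> bool" where
  "anti_pre_Lie_on scl V circ \<longleftrightarrow>
     vector_space_on scl V \<and> bilinear_op_on scl V circ \<and>
     (\<forall>x\<in>V. \<forall>y\<in>V. \<forall>z\<in>V.
        circ x (circ y z) - circ y (circ x z) = circ (bracket circ y x) z \<and>
        circ (bracket circ x y) z + circ (bracket circ y z) x + circ (bracket circ z x) y = 0)"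

definition anti_pre_Poisson_on ::
  "('k::field \<Rightarrow> 'v::ab_group_add \<Rightarrow> 'v) \<Rightarrow> 'v set \<Rightarrow> ('v \<Rightarrow> 'v \<Rightarrow> 'v) \<Rightarrow> ('v \<Rightarrow> 'v \<Rightarrow> 'v) \<Rightarrow> bool"
  where
  "anti_pre_Poisson_on scl V ast circ \<longleftrightarrow>
     anti_Zinbiel_on scl V ast \<and> anti_pre_Lie_on scl V circ \<and>
     (\<forall>x\<in>V. \<forall>y\<in>V. \<forall>z\<in>V.
        ast (circ x y - circ y x) z = ast y (circ x z) - circ x (ast y z) \<and>
        circ (ast x y + ast y x) z = - ast x (circ y z) - ast y (circ x z) \<and>
        circ z (ast x y + ast y x) + ast x (circ y z) + ast y (circ x z)
          = ast x (circ z y) + ast y (circ z x))"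

abbreviation anti_pre_Poisson ::
  "('k::field \<Rightarrow> 'a::ab_group_add \<Rightarrow> 'a) \<Rightarrow> ('a \<Rightarrow> 'a \<Rightarrow> 'a) \<Rightarrow> ('a \<Rightarrow> 'a \<Rightarrow> 'a) \<Rightarrow> bool" where
  "anti_pre_Poisson scl \<equiv> anti_pre_Poisson_on scl UNIV"

definition Lop :: "('a \<Rightarrow> 'a \<Rightarrow> 'a) \<Rightarrow> 'a \<Rightarrow> 'a \<Rightarrow> 'a" where
  "Lop m x = (\<lambda>y. m x y)"

definition Rop :: "('a \<Rightarrow> 'a \<Rightarrow> 'a) \<Rightarrow> 'a \<Rightarrow> 'a \<Rightarrow> 'a" where
  "Rop m x = (\<lambda>y. m y x)"

definition adop :: "('a \<Rightarrow> 'a \<Rightarrow> 'a) \<Rightarrow> 'a \<Rightarrow> 'a \<Rightarrow> 'a::ab_group_add" where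
  "adop circ x = Lop circ x - Rop circ x"

definition Lstar :: "('a \<Rightarrow> 'a \<Rightarrow> 'a) \<Rightarrow> 'a \<Rightarrow> 'a \<Rightarrow> 'a::ab_group_add" where
  "Lstar ast x = Lop ast x + Rop ast x"

section \<open>Dual space and tensor powers\<close>

definition fun_scale :: "'k::field \<Rightarrow> ('a \<Rightarrow> 'k) \<Rightarrow> 'a \<Rightarrow> 'k" where
  "fun_scale c \<zeta> = (\<lambda>x. c * \<zeta> x)"

definition dual :: "('k::field \<Rightarrow> 'a::ab_group_add \<Rightarrow> 'a) \<Rightarrow> ('a \<Rightarrow> 'k) set" where
  "dual scl = {\<zeta>. Vector_Spaces.linear scl (*) \<zeta>}"

text \<open>
  For a finite-dimensional \<open>A\<close> with dual \<open>A*\<close>, the tensor powers are realised by their pairing with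
  functionals: an element \<open>s\<close> of \<open>A \<otimes> A\<close> is the bilinear form \<open>\<zeta>, \<eta> \<mapsto> \<langle>s, \<zeta> \<otimes> \<eta>\<rangle>\<close> on \<open>A*\<close>, and likewise
  trilinear forms are used for \<open>A \<otimes> A \<otimes> A\<close>. The forms are extended by \<open>0\<close> to functions that are not
  linear, so that equality of tensors is equality of HOL functions. Lemma \<open>tensor_universal\<close> below
  confirms that no relations hold beyond those of the tensor product.
\<close>

type_synonym ('a, 'k) tens2 = "('a \<Rightarrow> 'k) \<Rightarrow> ('a \<Rightarrow> 'k) \<Rightarrow> 'k"
type_synonym ('a, 'k) tens3 = "('a \<Rightarrow> 'k) \<Rightarrow> ('a \<Rightarrow> 'k) \<Rightarrow> ('a \<Rightarrow> 'k) \<Rightarrow> 'k"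

definition tensor ::
  "('k::field \<Rightarrow> 'a::ab_group_add \<Rightarrow> 'a) \<Rightarrow> 'a \<Rightarrow> 'a \<Rightarrow> ('a, 'k) tens2" where
  "tensor scl x y = (\<lambda>\<zeta> \<eta>. if \<zeta> \<in> dual scl \<and> \<eta> \<in> dual scl then \<zeta> x * \<eta> y else 0)"

definition tensor3 ::
  "('k::field \<Rightarrow> 'a::ab_group_add \<Rightarrow> 'a) \<Rightarrow> 'a \<Rightarrow> 'a \<Rightarrow> 'a \<Rightarrow> ('a, 'k) tens3" where
  "tensor3 scl x y z = (\<lambda>\<zeta> \<eta> \<theta>.
     if \<zeta> \<in> dual scl \<and> \<eta> \<in> dual scl \<and> \<theta> \<in> dual scl then \<zeta> x * \<eta> y * \<theta> z else 0)"

definition tensor_sum ::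
  "('k::field \<Rightarrow> 'a::ab_group_add \<Rightarrow> 'a) \<Rightarrow> nat \<Rightarrow> (nat \<Rightarrow> 'a) \<Rightarrow> (nat \<Rightarrow> 'a) \<Rightarrow> ('a, 'k) tens2" where
  "tensor_sum scl n a b = (\<Sum>i<n. tensor scl (a i) (b i))"

definition tensor_square ::
  "('k::field \<Rightarrow> 'a::ab_group_add \<Rightarrow> 'a) \<Rightarrow> ('a, 'k) tens2 set" where
  "tensor_square scl = {s. \<exists>n a b. s = tensor_sum scl n a b}"

definition tens_scale :: "'k::field \<Rightarrow> ('a, 'k) tens2 \<Rightarrow> ('a, 'k) tens2" where
  "tens_scale c s = (\<lambda>\<zeta> \<eta>. c * s \<zeta> \<eta>)"

definition flip :: "('a, 'k) tens2 \<Rightarrow> ('a, 'k) tens2" where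
  "flip s = (\<lambda>\<zeta> \<eta>. s \<eta> \<zeta>)"

text \<open>
  \<open>tmap scl f g\<close> is \<open>f \<otimes> g\<close> on \<open>A \<otimes> A\<close> for linear maps \<open>f\<close> and \<open>g\<close> (see lemma \<open>tmap_tensor\<close>).
\<close>

definition tmap ::
  "('k::field \<Rightarrow> 'a::ab_group_add \<Rightarrow> 'a) \<Rightarrow> ('a \<Rightarrow> 'a) \<Rightarrow> ('a \<Rightarrow> 'a) \<Rightarrow> ('a, 'k) tens2 \<Rightarrow> ('a, 'k) tens2"
  where
  "tmap scl f g s =
     (\<lambda>\<zeta> \<eta>. if \<zeta> \<in> dual scl \<and> \<eta> \<in> dual scl then s (\<zeta> \<circ> f) (\<eta> \<circ> g) else 0)"

definition T_op ::
  "('k::field \<Rightarrow> 'a::ab_group_add \<Rightarrow> 'a) \<Rightarrow> ('a, 'k) tens2 \<Rightarrow> ('a \<Rightarrow> 'k) \<Rightarrow> 'a" where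
  "T_op scl s \<zeta> = (THE x. \<forall>\<eta>\<in>dual scl. \<eta> x = s \<zeta> \<eta>)"

definition dual_linear_iso ::
  "('k::field \<Rightarrow> 'a::ab_group_add \<Rightarrow> 'a) \<Rightarrow> (('a \<Rightarrow> 'k) \<Rightarrow> 'a) \<Rightarrow> bool" where
  "dual_linear_iso scl T \<longleftrightarrow>
     (\<forall>\<zeta>\<in>dual scl. \<forall>\<eta>\<in>dual scl. T (\<zeta> + \<eta>) = T \<zeta> + T \<eta>) \<and>
     (\<forall>c. \<forall>\<zeta>\<in>dual scl. T (fun_scale c \<zeta>) = scl c (T \<zeta>)) \<and>
     bij_betw T (dual scl) UNIV"

section \<open>Anti-pre-Poisson bialgebras\<close>

definition comultiplication ::
  "('k::field \<Rightarrow> 'a::ab_group_add \<Rightarrow> 'a) \<Rightarrow> ('a \<Rightarrow> ('a, 'k) tens2) \<Rightarrow> bool" where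
  "comultiplication scl D \<longleftrightarrow>
     Vector_Spaces.linear scl tens_scale D \<and> (\<forall>x. D x \<in> tensor_square scl)"

text \<open>The dual operation is given by \<open>\<langle>\<zeta> \<cdot> \<eta>, x\<rangle> = \<langle>\<zeta> \<otimes> \<eta>, D x\<rangle>\<close>.\<close>

definition dual_op :: "('a \<Rightarrow> ('a, 'k) tens2) \<Rightarrow> ('a \<Rightarrow> 'k) \<Rightarrow> ('a \<Rightarrow> 'k) \<Rightarrow> 'a \<Rightarrow> 'k" where
  "dual_op D \<zeta> \<eta> = (\<lambda>x. D x \<zeta> \<eta>)"

definition anti_pre_Poisson_coalgebra ::
  "('k::field \<Rightarrow> 'a::ab_group_add \<Rightarrow> 'a) \<Rightarrow>
   ('a \<Rightarrow> ('a, 'k) tens2) \<Rightarrow> ('a \<Rightarrow> ('a, 'k) tens2) \<Rightarrow> bool" where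
  "anti_pre_Poisson_coalgebra scl \<Delta> \<delta> \<longleftrightarrow>
     comultiplication scl \<Delta> \<and> comultiplication scl \<delta> \<and>
     anti_pre_Poisson_on fun_scale (dual scl) (dual_op \<Delta>) (dual_op \<delta>)"

definition anti_pre_Poisson_bialgebra ::
  "('k::field \<Rightarrow> 'a::ab_group_add \<Rightarrow> 'a) \<Rightarrow> ('a \<Rightarrow> 'a \<Rightarrow> 'a) \<Rightarrow> ('a \<Rightarrow> 'a \<Rightarrow> 'a) \<Rightarrow>
   ('a \<Rightarrow> ('a, 'k) tens2) \<Rightarrow> ('a \<Rightarrow> ('a, 'k) tens2) \<Rightarrow> bool" where
  "anti_pre_Poisson_bialgebra scl ast circ \<Delta> \<delta> \<longleftrightarrow>
     anti_pre_Poisson scl ast circ \<and>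
     anti_pre_Poisson_coalgebra scl \<Delta> \<delta> \<and>
     (let T = tmap scl; La = Lop ast; Ra = Rop ast; Lc = Lop circ; Rc = Rop circ;
          ad = adop circ; Ls = Lstar ast
      in \<forall>x y.
        \<Delta> (star ast x y) = T id (Ls x) (\<Delta> y) - T (La y) id (\<Delta> x) \<and>
        \<Delta> (ast x y) + flip (\<Delta> (ast x y))
          = T (La x) id (\<Delta> y + flip (\<Delta> y)) - T id (Ra y) (\<Delta> x) \<and>
        \<delta> (bracket circ x y)
          = (T id (ad x) (\<delta> y) - T (Lc x) id (\<delta> y)) - (T id (ad y) (\<delta> x) - T (Lc y) id (\<delta> x)) \<and>
        (let s = \<delta> (circ x y) - T (Lc x) id (\<delta> y) - T id (Lc x) (\<delta> y) + T id (Rc y) (\<delta> x)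
         in s - flip s = 0) \<and>
        \<delta> (star ast x y)
          = T id (Ls x) (\<delta> y) + T id (Ls y) (\<delta> x) + T (Lc x) id (\<Delta> y) + T (Lc y) id (\<Delta> x) \<and>
        \<Delta> (bracket circ x y)
          = - T (Lc x) id (\<Delta> y) - T id (Ls y) (\<delta> x) - T (La y) id (\<delta> x) + T id (ad x) (\<Delta> y) \<and>
        (let s = T (Lc x) id (\<Delta> y) + T id (Lc x) (\<Delta> y) + T id (Ra y) (\<delta> x)
         in \<Delta> (circ x y) + flip (\<Delta> (circ x y)) = s + flip s) \<and>
        \<delta> (ast x y) - flip (\<delta> (ast x y))
          = T id (La x) (\<delta> y) - flip (T (La x) id (\<delta> y))
            - T (Lc x) id (\<Delta> y) - flip (T id (Lc x) (\<Delta> y))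
            - T id (Ra y) (\<delta> x) - flip (T id (Rc y) (\<Delta> x)))"

section \<open>Quasi-triangular and factorizable bialgebras\<close>

definition APP_D ::
  "('k::field \<Rightarrow> 'a::ab_group_add \<Rightarrow> 'a) \<Rightarrow> ('a \<Rightarrow> 'a \<Rightarrow> 'a) \<Rightarrow>
   nat \<Rightarrow> (nat \<Rightarrow> 'a) \<Rightarrow> (nat \<Rightarrow> 'a) \<Rightarrow> ('a, 'k) tens3" where
  "APP_D scl ast n a b = (\<Sum>i<n. \<Sum>j<n.
      tensor3 scl (a i) (ast (b i) (a j)) (b j)
    - tensor3 scl (ast (a i) (a j)) (b i) (b j)
    + tensor3 scl (a i) (a j) (star ast (b i) (b j)))"

definition APP_S ::
  "('k::field \<Rightarrow> 'a::ab_group_add \<Rightarrow> 'a) \<Rightarrow> ('a \<Rightarrow> 'a \<Rightarrow> 'a) \<Rightarrow>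
   nat \<Rightarrow> (nat \<Rightarrow> 'a) \<Rightarrow> (nat \<Rightarrow> 'a) \<Rightarrow> ('a, 'k) tens3" where
  "APP_S scl circ n a b = (\<Sum>i<n. \<Sum>j<n.
      tensor3 scl (circ (a i) (a j)) (b i) (b j)
    + tensor3 scl (a i) (circ (b i) (a j)) (b j)
    - tensor3 scl (a i) (a j) (bracket circ (b i) (b j)))"

text \<open>
  \<open>APP_D\<close> and \<open>APP_S\<close> do not depend on the chosen expression of \<open>r\<close> as a sum of elementary tensors
  (lemmas \<open>APP_D_cong\<close> and \<open>APP_S_cong\<close> below).
\<close>

definition solves_APP_YBE ::
  "('k::field \<Rightarrow> 'a::ab_group_add \<Rightarrow> 'a) \<Rightarrow> ('a \<Rightarrow> 'a \<Rightarrow> 'a) \<Rightarrow> ('a \<Rightarrow> 'a \<Rightarrow> 'a) \<Rightarrow>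
   ('a, 'k) tens2 \<Rightarrow> bool" where
  "solves_APP_YBE scl ast circ r \<longleftrightarrow>
     (\<exists>n a b. r = tensor_sum scl n a b \<and> APP_D scl ast n a b = 0 \<and> APP_S scl circ n a b = 0)"

definition tensor_invariant ::
  "('k::field \<Rightarrow> 'a::ab_group_add \<Rightarrow> 'a) \<Rightarrow> ('a \<Rightarrow> 'a \<Rightarrow> 'a) \<Rightarrow> ('a \<Rightarrow> 'a \<Rightarrow> 'a) \<Rightarrow>
   ('a, 'k) tens2 \<Rightarrow> bool" where
  "tensor_invariant scl ast circ s \<longleftrightarrow>
     (\<forall>x. tmap scl id (Lstar ast x) s + tmap scl (Lop ast x) id s = 0 \<and>
          tmap scl (Lop circ x) id s - tmap scl id (adop circ x) s = 0)"

definition Delta_r ::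
  "('k::field \<Rightarrow> 'a::ab_group_add \<Rightarrow> 'a) \<Rightarrow> ('a \<Rightarrow> 'a \<Rightarrow> 'a) \<Rightarrow>
   ('a, 'k) tens2 \<Rightarrow> 'a \<Rightarrow> ('a, 'k) tens2" where
  "Delta_r scl ast r x = - (tmap scl id (Lstar ast x) r + tmap scl (Lop ast x) id r)"

definition delta_r ::
  "('k::field \<Rightarrow> 'a::ab_group_add \<Rightarrow> 'a) \<Rightarrow> ('a \<Rightarrow> 'a \<Rightarrow> 'a) \<Rightarrow>
   ('a, 'k) tens2 \<Rightarrow> 'a \<Rightarrow> ('a, 'k) tens2" where
  "delta_r scl circ r x = tmap scl (Lop circ x) id r - tmap scl id (adop circ x) r"

definition quasi_triangular ::
  "('k::field \<Rightarrow> 'a::ab_group_add \<Rightarrow> 'a) \<Rightarrow> ('a \<Rightarrow> 'a \<Rightarrow> 'a) \<Rightarrow> ('a \<Rightarrow> 'a \<Rightarrow> 'a) \<Rightarrow>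
   ('a, 'k) tens2 \<Rightarrow> bool" where
  "quasi_triangular scl ast circ r \<longleftrightarrow>
     r \<in> tensor_square scl \<and>
     anti_pre_Poisson_bialgebra scl ast circ (Delta_r scl ast r) (delta_r scl circ r) \<and>
     solves_APP_YBE scl ast circ r \<and>
     tensor_invariant scl ast circ (r + flip r)"

definition factorizable ::
  "('k::field \<Rightarrow> 'a::ab_group_add \<Rightarrow> 'a) \<Rightarrow> ('a \<Rightarrow> 'a \<Rightarrow> 'a) \<Rightarrow> ('a \<Rightarrow> 'a \<Rightarrow> 'a) \<Rightarrow>
   ('a, 'k) tens2 \<Rightarrow> bool" where
  "factorizable scl ast circ r \<longleftrightarrow>
     quasi_triangular scl ast circ r \<and> dual_linear_iso scl (T_op scl (r + flip r))"

section \<open>Quadratic Rota-Baxter anti-pre-Poisson algebras\<close>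

definition bilinear_form ::
  "('k::field \<Rightarrow> 'a::ab_group_add \<Rightarrow> 'a) \<Rightarrow> ('a \<Rightarrow> 'a \<Rightarrow> 'k) \<Rightarrow> bool" where
  "bilinear_form scl \<omega> \<longleftrightarrow>
     (\<forall>x. Vector_Spaces.linear scl (*) (\<lambda>y. \<omega> x y)) \<and>
     (\<forall>y. Vector_Spaces.linear scl (*) (\<lambda>x. \<omega> x y))"

definition nondegenerate :: "('a::ab_group_add \<Rightarrow> 'a \<Rightarrow> 'k::field) \<Rightarrow> bool" where
  "nondegenerate \<omega> \<longleftrightarrow>
     (\<forall>x. (\<forall>y. \<omega> x y = 0) \<longrightarrow> x = 0) \<and> (\<forall>y. (\<forall>x. \<omega> x y = 0) \<longrightarrow> y = 0)"

definition sharp :: "('a \<Rightarrow> 'a \<Rightarrow> 'k) \<Rightarrow> 'a \<Rightarrow> 'a \<Rightarrow> 'k" where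
  "sharp \<omega> x = (\<lambda>y. \<omega> x y)"

definition quadratic_anti_pre_Poisson ::
  "('k::field \<Rightarrow> 'a::ab_group_add \<Rightarrow> 'a) \<Rightarrow> ('a \<Rightarrow> 'a \<Rightarrow> 'a) \<Rightarrow> ('a \<Rightarrow> 'a \<Rightarrow> 'a) \<Rightarrow>
   ('a \<Rightarrow> 'a \<Rightarrow> 'k) \<Rightarrow> bool" where
  "quadratic_anti_pre_Poisson scl ast circ \<omega> \<longleftrightarrow>
     anti_pre_Poisson scl ast circ \<and>
     bilinear_form scl \<omega> \<and> nondegenerate \<omega> \<and> (\<forall>x y. \<omega> x y = \<omega> y x) \<and>
     (\<forall>x y z. \<omega> (ast x y) z = - \<omega> y (star ast x z)) \<and>
     (\<forall>x y z. \<omega> (circ x y) z = \<omega> y (bracket circ x z))"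

definition Rota_Baxter ::
  "('k::field \<Rightarrow> 'a::ab_group_add \<Rightarrow> 'a) \<Rightarrow> 'k \<Rightarrow> ('a \<Rightarrow> 'a \<Rightarrow> 'a) \<Rightarrow> ('a \<Rightarrow> 'a) \<Rightarrow> bool" where
  "Rota_Baxter scl lam m P \<longleftrightarrow>
     (\<forall>x y. m (P x) (P y) = P (m (P x) y + m x (P y) + scl lam (m x y)))"

definition quadratic_Rota_Baxter_APP ::
  "('k::field \<Rightarrow> 'a::ab_group_add \<Rightarrow> 'a) \<Rightarrow> 'k \<Rightarrow> ('a \<Rightarrow> 'a \<Rightarrow> 'a) \<Rightarrow> ('a \<Rightarrow> 'a \<Rightarrow> 'a) \<Rightarrow>
   ('a \<Rightarrow> 'a) \<Rightarrow> ('a \<Rightarrow> 'a \<Rightarrow> 'k) \<Rightarrow> bool" where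
  "quadratic_Rota_Baxter_APP scl lam ast circ P \<omega> \<longleftrightarrow>
     quadratic_anti_pre_Poisson scl ast circ \<omega> \<and>
     Vector_Spaces.linear scl scl P \<and>
     Rota_Baxter scl lam ast P \<and> Rota_Baxter scl lam circ P \<and>
     (\<forall>x y. \<omega> (P x) y + \<omega> x (P y) + lam * \<omega> x y = 0)"

section \<open>The encoding of tensors\<close>

lemma sum_fun2_apply: "(\<Sum>i\<in>I. f i) \<zeta> \<eta> = (\<Sum>i\<in>I. f i \<zeta> \<eta>)"
  for f :: "'i \<Rightarrow> 'p \<Rightarrow> 'q \<Rightarrow> 'r::comm_monoid_add"
  by (induction I rule: infinite_finite_induct) auto

lemma sum_fun3_apply: "(\<Sum>i\<in>I. f i) \<zeta> \<eta> \<theta> = (\<Sum>i\<in>I. f i \<zeta> \<eta> \<theta>)"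
  for f :: "'i \<Rightarrow> 'p \<Rightarrow> 'q \<Rightarrow> 's \<Rightarrow> 'r::comm_monoid_add"
  by (induction I rule: infinite_finite_induct) auto

lemma tensor_sum_apply:
  assumes "\<zeta> \<in> dual scl" "\<eta> \<in> dual scl"
  shows "tensor_sum scl n a b \<zeta> \<eta> = (\<Sum>i<n. \<zeta> (a i) * \<eta> (b i))"
  using assms by (simp add: tensor_sum_def sum_fun2_apply tensor_def)

lemma dual_comp:
  assumes "Vector_Spaces.linear scl scl f" "\<zeta> \<in> dual scl"
  shows "\<zeta> \<circ> f \<in> dual scl"
  using assms by (auto simp: dual_def Vector_Spaces.linear_iff)

lemma tmap_tensor:
  assumes "Vector_Spaces.linear scl scl f" "Vector_Spaces.linear scl scl g"
  shows "tmap scl f g (tensor scl x y) = tensor scl (f x) (g y)"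
  using dual_comp[OF assms(1)] dual_comp[OF assms(2)]
  by (auto simp: tmap_def tensor_def fun_eq_iff)

lemma tensor_universal:
  fixes scl' :: "'k::field \<Rightarrow> 'b::ab_group_add \<Rightarrow> 'b"
  assumes fd: "finite_dimensional_vector_space scl Basis" and vs: "vector_space scl'"
    and bil: "\<And>x. Vector_Spaces.linear scl scl' (\<lambda>y. \<beta> x y)"
      "\<And>y. Vector_Spaces.linear scl scl' (\<lambda>x. \<beta> x y)"
    and eq: "tensor_sum scl n a b = tensor_sum scl m c d"
  shows "(\<Sum>i<n. \<beta> (a i) (b i)) = (\<Sum>i<m. \<beta> (c i) (d i))"
proof -
  interpret A: finite_dimensional_vector_space scl Basis by (rule fd)
  interpret V: vector_space scl' by (rule vs)
  let ?R = "A.representation Basis"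
  have dual: "(\<lambda>x. ?R x u) \<in> dual scl" for u
    unfolding dual_def Vector_Spaces.linear_iff
    using A.independent_Basis A.span_Basis A.vector_space_axioms
    by (auto simp: A.representation_add A.representation_scale intro!: vector_space.intro
        simp: algebra_simps)
  have expand: "x = (\<Sum>u\<in>Basis. scl (?R x u) u)" for x
    using A.sum_representation_eq[OF A.independent_Basis _ A.finite_Basis order_refl, of x]
    by (simp add: A.span_Basis)
  have lin1: "f x = (\<Sum>u\<in>Basis. scl' (?R x u) (f u))" if "Vector_Spaces.linear scl scl' f" for f x
  proof -
    interpret f: Vector_Spaces.linear scl scl' f by (rule that)
    show ?thesis by (subst expand[of x]) (simp add: f.sum f.scale)
  qed
  have form: "\<beta> x y = (\<Sum>u\<in>Basis. \<Sum>v\<in>Basis. scl' (?R x u * ?R y v) (\<beta> u v))" for x y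
    by (subst lin1[OF bil(2)], subst lin1[OF bil(1)]) (simp add: V.scale_sum_right)
  have total: "(\<Sum>i<k. \<beta> (p i) (q i)) =
      (\<Sum>u\<in>Basis. \<Sum>v\<in>Basis. scl' (tensor_sum scl k p q (\<lambda>x. ?R x u) (\<lambda>x. ?R x v)) (\<beta> u v))"
    for k :: nat and p q
  proof -
    have "(\<Sum>i<k. \<beta> (p i) (q i)) =
        (\<Sum>i<k. \<Sum>u\<in>Basis. \<Sum>v\<in>Basis. scl' (?R (p i) u * ?R (q i) v) (\<beta> u v))"
      by (subst form) simp
    also have "\<dots> = (\<Sum>u\<in>Basis. \<Sum>v\<in>Basis. \<Sum>i<k. scl' (?R (p i) u * ?R (q i) v) (\<beta> u v))"
      by (subst sum.swap) (auto intro!: sum.cong sum.swap)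
    finally show ?thesis
      by (simp add: tensor_sum_apply dual V.scale_sum_left)
  qed
  show ?thesis unfolding total eq ..
qed

lemma vector_space_mult: "vector_space ((*) :: 'b::field \<Rightarrow> 'b \<Rightarrow> 'b)"
  by unfold_locales (auto simp: algebra_simps)

lemma bilinear_form_iff:
  assumes "vector_space scl"
  shows "bilinear_form scl \<omega> \<longleftrightarrow>
    (\<forall>x y z. \<omega> (x + y) z = \<omega> x z + \<omega> y z \<and> \<omega> x (y + z) = \<omega> x y + \<omega> x z) \<and>
    (\<forall>c x y. \<omega> (scl c x) y = c * \<omega> x y \<and> \<omega> x (scl c y) = c * \<omega> x y)"
  using assms vector_space_mult
  unfolding bilinear_form_def Vector_Spaces.linear_iff by auto

lemma double_sum_cong:
  assumes fd: "finite_dimensional_vector_space scl Basis"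
    and F: "\<And>z w. bilinear_form scl (\<lambda>x y. F x y z w)" "\<And>x y. bilinear_form scl (\<lambda>z w. F x y z w)"
    and eq: "tensor_sum scl n a b = tensor_sum scl m c d"
  shows "(\<Sum>i<n. \<Sum>j<n. F (a i) (b i) (a j) (b j)) = (\<Sum>i<m. \<Sum>j<m. F (c i) (d i) (c j) (d j))"
proof -
  note univ = tensor_universal[OF fd vector_space_mult _ _ eq]
  have "(\<Sum>i<n. \<Sum>j<n. F (a i) (b i) (a j) (b j)) = (\<Sum>i<n. \<Sum>j<m. F (a i) (b i) (c j) (d j))"
  proof (rule sum.cong[OF refl])
    fix i
    show "(\<Sum>j<n. F (a i) (b i) (a j) (b j)) = (\<Sum>j<m. F (a i) (b i) (c j) (d j))"
      using F(2) by (intro univ[of "\<lambda>z w. F (a i) (b i) z w"]) (auto simp: bilinear_form_def)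
  qed
  also have "\<dots> = (\<Sum>j<m. \<Sum>i<n. F (a i) (b i) (c j) (d j))"
    by (rule sum.swap)
  also have "\<dots> = (\<Sum>j<m. \<Sum>i<m. F (c i) (d i) (c j) (d j))"
  proof (rule sum.cong[OF refl])
    fix j
    show "(\<Sum>i<n. F (a i) (b i) (c j) (d j)) = (\<Sum>i<m. F (c i) (d i) (c j) (d j))"
      using F(1) by (intro univ[of "\<lambda>x y. F x y (c j) (d j)"]) (auto simp: bilinear_form_def)
  qed
  also have "\<dots> = (\<Sum>i<m. \<Sum>j<m. F (c i) (d i) (c j) (d j))"
    by (rule sum.swap)
  finally show ?thesis .
qed

lemma APP_D_cong:
  assumes fd: "finite_dimensional_vector_space scl Basis" and op: "bilinear_op_on scl UNIV ast"
    and eq: "tensor_sum scl n a b = tensor_sum scl m c d"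
  shows "APP_D scl ast n a b = APP_D scl ast m c d"
proof (intro ext)
  fix \<zeta> \<eta> \<theta>
  show "APP_D scl ast n a b \<zeta> \<eta> \<theta> = APP_D scl ast m c d \<zeta> \<eta> \<theta>"
  proof (cases "\<zeta> \<in> dual scl \<and> \<eta> \<in> dual scl \<and> \<theta> \<in> dual scl")
    case False
    show ?thesis
      by (simp only: APP_D_def sum_fun3_apply tensor3_def False if_False plus_fun_apply
          fun_diff_def) simp
  next
    case True
    have vs: "vector_space scl"
      using fd by (simp add: finite_dimensional_vector_space_def)
    have op_simps: "ast (x + y) z = ast x z + ast y z" "ast x (y + z) = ast x y + ast x z"
      "ast (scl k x) y = scl k (ast x y)" "ast x (scl k y) = scl k (ast x y)" for x y z k
      using op by (auto simp: bilinear_op_on_def)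
    have dual_simps: "\<xi> (x + y) = \<xi> x + \<xi> y" "\<xi> (scl k x) = k * \<xi> x"
      if "\<xi> \<in> {\<zeta>, \<eta>, \<theta>}" for \<xi> x y k
      using that True by (auto simp: dual_def Vector_Spaces.linear_iff)
    note simps = star_def op_simps dual_simps[of \<zeta>, simplified] dual_simps[of \<eta>, simplified]
      dual_simps[of \<theta>, simplified]
    define F where "F x y z w = \<zeta> x * \<eta> (ast y z) * \<theta> w - \<zeta> (ast x z) * \<eta> y * \<theta> w
      + \<zeta> x * \<eta> z * \<theta> (star ast y w)" for x y z w
    have "bilinear_form scl (\<lambda>x y. F x y z w)" "bilinear_form scl (\<lambda>z w. F x y z w)" for x y z w
      by (simp_all add: bilinear_form_iff[OF vs] F_def simps algebra_simps)
    from double_sum_cong[OF fd this eq] True show ?thesis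
      by (simp add: APP_D_def sum_fun3_apply F_def tensor3_def)
  qed
qed

lemma APP_S_cong:
  assumes fd: "finite_dimensional_vector_space scl Basis" and op: "bilinear_op_on scl UNIV circ"
    and eq: "tensor_sum scl n a b = tensor_sum scl m c d"
  shows "APP_S scl circ n a b = APP_S scl circ m c d"
proof (intro ext)
  fix \<zeta> \<eta> \<theta>
  show "APP_S scl circ n a b \<zeta> \<eta> \<theta> = APP_S scl circ m c d \<zeta> \<eta> \<theta>"
  proof (cases "\<zeta> \<in> dual scl \<and> \<eta> \<in> dual scl \<and> \<theta> \<in> dual scl")
    case False
    show ?thesis
      by (simp only: APP_S_def sum_fun3_apply tensor3_def False if_False plus_fun_apply
          fun_diff_def) simp
  next
    case True
    have vs: "vector_space scl"
      using fd by (simp add: finite_dimensional_vector_space_def)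
    have op_simps: "circ (x + y) z = circ x z + circ y z" "circ x (y + z) = circ x y + circ x z"
      "circ (scl k x) y = scl k (circ x y)" "circ x (scl k y) = scl k (circ x y)" for x y z k
      using op by (auto simp: bilinear_op_on_def)
    have dual_simps: "\<xi> (x + y) = \<xi> x + \<xi> y" "\<xi> (scl k x) = k * \<xi> x"
      if "\<xi> \<in> {\<zeta>, \<eta>, \<theta>}" for \<xi> x y k
      using that True by (auto simp: dual_def Vector_Spaces.linear_iff)
    have br: "\<theta> (bracket circ x y) = \<theta> (circ x y) - \<theta> (circ y x)" for x y
      using dual_simps(1)[of \<theta> "bracket circ x y" "circ y x"] by (simp add: bracket_def)
    note simps = br op_simps dual_simps[of \<zeta>, simplified] dual_simps[of \<eta>, simplified]
      dual_simps[of \<theta>, simplified]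
    define F where "F x y z w = \<zeta> (circ x z) * \<eta> y * \<theta> w + \<zeta> x * \<eta> (circ y z) * \<theta> w
      - \<zeta> x * \<eta> z * \<theta> (bracket circ y w)" for x y z w
    have "bilinear_form scl (\<lambda>x y. F x y z w)" "bilinear_form scl (\<lambda>z w. F x y z w)" for x y z w
      by (simp_all add: bilinear_form_iff[OF vs] F_def simps algebra_simps)
    from double_sum_cong[OF fd this eq] True show ?thesis
      by (simp add: APP_S_def sum_fun3_apply F_def tensor3_def)
  qed
qed

end

theory Submission
  imports Defs
begin

text \<open>
  A non-degenerate symmetric form \<open>\<omega>\<close> identifies \<open>A*\<close> with \<open>A\<close>, and thereby a tensor \<open>s \<in> A \<otimes> A\<close> with
  the linear operator \<open>S = T_s \<omega>\<^sup>\<sharp>\<close> on \<open>A\<close>, for which \<open>\<langle>s, \<omega>\<^sup>\<sharp>(u) \<otimes> \<omega>\<^sup>\<sharp>(v)\<rangle> = \<omega>(v, S u)\<close>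
  (\<open>op_tensor\<close>). Under this dictionary \<open>(f \<otimes> g) s\<close> becomes \<open>g S f*\<close> and \<open>\<tau>(s)\<close> becomes the adjoint
  \<open>S*\<close>. If \<open>\<omega>\<close> is invariant, all multiplication operators have multiplication operators as adjoints:
  \<open>L_\<ast>(x)* = - L_\<star>(x)\<close>, \<open>R_\<ast>(x)* = R_\<ast>(x)\<close>, \<open>L_\<circ>(x)* = ad(x)\<close>, \<open>R_\<circ>(x)* = - R_\<circ>(x)\<close>. The
  theorem turns into statements about the operator \<open>P\<close> that corresponds to \<open>r\<close>.

  The condition \<open>\<omega>(P x, y) + \<omega>(x, P y) + \<lambda> \<omega>(x, y) = 0\<close> says \<open>P* = - P - \<lambda>\<close>, that is, \<open>r + \<tau>(r)\<close>
  corresponds to \<open>- \<lambda> I\<close>. So \<open>r + \<tau>(r)\<close> and \<open>\<omega>\<close> determine each other, the invariance of one is the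
  invariance of the other, and the bijectivity of \<open>T_{r + \<tau>(r)}\<close> is the non-degeneracy of \<open>\<omega>\<close>.
  The two components of the APP-YBE become
  \<open>P u \<cdot> P* w - P (u \<cdot> P* w) - P* (P u \<cdot> w) = 0\<close> for both products, and with \<open>P* = - P - \<lambda>\<close>
  these are the Rota-Baxter identities (\<open>YBE_at\<close>, \<open>solves_APP_YBE_iff\<close>). This gives the first part.

  For the second part it remains that \<open>r\<close> defines a bialgebra. Here \<open>\<Delta>_r(x)\<close> and \<open>\<delta>_r(x)\<close> correspond
  to the commutators \<open>[P, L_\<star>(x)]\<close> and \<open>[P, ad(x)]\<close>, and their flips to \<open>- [P, L_\<ast>(x)]\<close> and
  \<open>[P, L_\<circ>(x)]\<close>. Since \<open>[P, _]\<close> is a derivation of the operator algebra, each of the eight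
  compatibility conditions is the image under \<open>[P, _]\<close> of an identity between multiplication operators
  which holds in every anti-pre-Poisson algebra (\<open>bialgebra_compatibilities\<close>). The products on \<open>A*\<close>
  dual to \<open>\<Delta>_r\<close> and \<open>\<delta>_r\<close> are the Rota-Baxter products \<open>P u \<cdot> v + u \<cdot> P v + \<lambda> u \<cdot> v\<close>. For these,
  \<open>P\<close> and \<open>P + \<lambda>\<close> are homomorphisms to \<open>A\<close>, and as \<open>\<lambda> \<noteq> 0\<close> they embed \<open>A*\<close> into \<open>A \<times> A\<close>. So \<open>A*\<close>
  inherits all identities of \<open>A\<close> (\<open>anti_pre_Poisson_on_jointly_embedded\<close>, \<open>coalgebra\<close>).
\<close>

section \<open>Bilinear operations and subalgebras of products\<close>

lemma bilinear_op_simps: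
  assumes "bilinear_op_on scl UNIV m"
  shows "m (x + y) z = m x z + m y z" "m x (y + z) = m x y + m x z"
    "m (scl c x) y = scl c (m x y)" "m x (scl c y) = scl c (m x y)"
    "m (- x) y = - m x y" "m x (- y) = - m x y"
    "m (x - y) z = m x z - m y z" "m x (y - z) = m x y - m x z"
proof -
  show add: "m (x + y) z = m x z + m y z" "m x (y + z) = m x y + m x z" for x y z
    using assms by (auto simp: bilinear_op_on_def)
  show "m (scl c x) y = scl c (m x y)" "m x (scl c y) = scl c (m x y)"
    using assms by (auto simp: bilinear_op_on_def)
  show "m (x - y) z = m x z - m y z" "m x (y - z) = m x y - m x z" for x y z
    using add(1)[of "x - y" y z] add(2)[of x "y - z" z] by (simp_all add: algebra_simps)
  from this(1)[of 0 x y] this(2)[of x 0 y] show "m (- x) y = - m x y" "m x (- y) = - m x y"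
    using add(1)[of 0 0 y] add(2)[of x 0 0] by simp_all
qed

text \<open>
  The axioms are identities, so they pass to every algebra that embeds into a power of \<open>A\<close>. The
  embedding is given by its components, the functions in \<open>F\<close>.
\<close>

lemma anti_pre_Poisson_on_jointly_embedded:
  fixes scl :: "'k::field \<Rightarrow> 'a::ab_group_add \<Rightarrow> 'a" and scl' :: "'k \<Rightarrow> 'b::ab_group_add \<Rightarrow> 'b"
    and F :: "('b \<Rightarrow> 'a) set"
  assumes app: "anti_pre_Poisson scl ast circ"
    and vs: "vector_space_on scl' V"
    and closed: "\<And>x y. x \<in> V \<Longrightarrow> y \<in> V \<Longrightarrow> ast' x y \<in> V" "\<And>x y. x \<in> V \<Longrightarrow> y \<in> V \<Longrightarrow> circ' x y \<in> V"
    and f_add: "\<And>f x y. f \<in> F \<Longrightarrow> x \<in> V \<Longrightarrow> y \<in> V \<Longrightarrow> f (x + y) = f x + f y"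
    and f_scale: "\<And>f c x. f \<in> F \<Longrightarrow> x \<in> V \<Longrightarrow> f (scl' c x) = scl c (f x)"
    and f_ast: "\<And>f x y. f \<in> F \<Longrightarrow> x \<in> V \<Longrightarrow> y \<in> V \<Longrightarrow> f (ast' x y) = ast (f x) (f y)"
    and f_circ: "\<And>f x y. f \<in> F \<Longrightarrow> x \<in> V \<Longrightarrow> y \<in> V \<Longrightarrow> f (circ' x y) = circ (f x) (f y)"
    and inj: "\<And>x y. x \<in> V \<Longrightarrow> y \<in> V \<Longrightarrow> (\<And>f. f \<in> F \<Longrightarrow> f x = f y) \<Longrightarrow> x = y"
  shows "anti_pre_Poisson_on scl' V ast' circ'"
proof -
  have op: "bilinear_op_on scl UNIV ast" "bilinear_op_on scl UNIV circ"
    using app by (simp_all add: anti_pre_Poisson_on_def anti_Zinbiel_on_def anti_pre_Lie_on_def)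
  note op_simps = bilinear_op_simps[OF op(1)] bilinear_op_simps[OF op(2)]
  interpret V': vector_space scl' using vs by (simp add: vector_space_on_def)
  have sub: "V'.subspace V" using vs by (simp add: vector_space_on_def)
  note mem = V'.subspace_add[OF sub] V'.subspace_diff[OF sub] V'.subspace_neg[OF sub]
    V'.subspace_scale[OF sub] V'.subspace_0[OF sub] closed
  have f_diff: "f (x - y) = f x - f y" if "f \<in> F" "x \<in> V" "y \<in> V" for f x y
    using f_add[of f "x - y" y] that by (simp add: mem algebra_simps)
  have f_0: "f 0 = 0" if "f \<in> F" for f
    using f_diff[OF that, of 0 0] by (simp add: mem)
  have f_neg: "f (- x) = - f x" if "f \<in> F" "x \<in> V" for f x
    using f_diff[of f 0 x] that by (simp add: mem f_0)
  note f_simps = f_add f_scale f_ast f_circ f_diff f_0 f_neg mem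
  have Z: "ast x (ast y z) = - ast (ast x y + ast y x) z \<and>
        - ast (ast x y + ast y x) z = - ast (ast z y + ast y z) x \<and>
        - ast (ast z y + ast y z) x = ast z (ast y x) \<and>
        ast z (ast x y) = ast x (ast z y)"
    and L: "circ x (circ y z) - circ y (circ x z) = circ (bracket circ y x) z \<and>
        circ (bracket circ x y) z + circ (bracket circ y z) x + circ (bracket circ z x) y = 0"
    and PP: "ast (circ x y - circ y x) z = ast y (circ x z) - circ x (ast y z) \<and>
        circ (ast x y + ast y x) z = - ast x (circ y z) - ast y (circ x z) \<and>
        circ z (ast x y + ast y x) + ast x (circ y z) + ast y (circ x z)
          = ast x (circ z y) + ast y (circ z x)" for x y z
    using app unfolding anti_pre_Poisson_on_def anti_Zinbiel_on_def anti_pre_Lie_on_def by blast+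
  note axioms = Z[THEN conjunct1] Z[THEN conjunct2, THEN conjunct1]
    Z[THEN conjunct2, THEN conjunct2, THEN conjunct1] Z[THEN conjunct2, THEN conjunct2, THEN conjunct2]
    L[THEN conjunct1] L[THEN conjunct2]
    PP[THEN conjunct1] PP[THEN conjunct2, THEN conjunct1] PP[THEN conjunct2, THEN conjunct2]
  have "bilinear_op_on scl' V ast'" "bilinear_op_on scl' V circ'"
    unfolding bilinear_op_on_def by (auto intro!: inj simp: f_simps op_simps)
  moreover have "ast' x (ast' y z) = - ast' (ast' x y + ast' y x) z \<and>
        - ast' (ast' x y + ast' y x) z = - ast' (ast' z y + ast' y z) x \<and>
        - ast' (ast' z y + ast' y z) x = ast' z (ast' y x) \<and>
        ast' z (ast' x y) = ast' x (ast' z y)" if "x \<in> V" "y \<in> V" "z \<in> V" for x y z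
    by (insert that, intro conjI inj; simp only: f_simps; rule axioms)
  moreover have "circ' x (circ' y z) - circ' y (circ' x z) = circ' (bracket circ' y x) z \<and>
        circ' (bracket circ' x y) z + circ' (bracket circ' y z) x + circ' (bracket circ' z x) y = 0"
    if "x \<in> V" "y \<in> V" "z \<in> V" for x y z
    unfolding bracket_def
    by (insert that, intro conjI inj; simp only: f_simps; rule axioms[unfolded bracket_def])
  moreover have "ast' (circ' x y - circ' y x) z = ast' y (circ' x z) - circ' x (ast' y z) \<and>
        circ' (ast' x y + ast' y x) z = - ast' x (circ' y z) - ast' y (circ' x z) \<and>
        circ' z (ast' x y + ast' y x) + ast' x (circ' y z) + ast' y (circ' x z)
          = ast' x (circ' z y) + ast' y (circ' z x)" if "x \<in> V" "y \<in> V" "z \<in> V" for x y z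
    by (insert that, intro conjI inj; simp only: f_simps; rule axioms)
  ultimately show ?thesis
    unfolding anti_pre_Poisson_on_def anti_Zinbiel_on_def anti_pre_Lie_on_def
    using vs by blast
qed

section \<open>The dual space and tensors\<close>

lemma vector_space_on_dual:
  fixes scl :: "'k::field \<Rightarrow> 'a::ab_group_add \<Rightarrow> 'a"
  assumes "vector_space scl"
  shows "vector_space_on fun_scale (dual scl)"
proof -
  have "vector_space (fun_scale :: 'k \<Rightarrow> ('a \<Rightarrow> 'k) \<Rightarrow> _)"
    by unfold_locales (auto simp: fun_scale_def algebra_simps)
  moreover from this interpret vector_space "fun_scale :: 'k \<Rightarrow> ('a \<Rightarrow> 'k) \<Rightarrow> _" .
  have "subspace (dual scl)"
    using assms vector_space_mult
    by (auto simp: subspace_def dual_def Vector_Spaces.linear_iff fun_scale_def algebra_simps)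
  ultimately show ?thesis by (simp add: vector_space_on_def)
qed

lemma flip_tmap: "flip (tmap scl f g s) = tmap scl g f (flip s)"
  by (auto simp: flip_def tmap_def fun_eq_iff)

lemma flip_add: "flip (s + t) = flip s + flip t"
  and flip_diff: "flip (s - t) = flip s - flip t"
  and flip_minus: "flip (- s) = - flip s"
  by (auto simp: flip_def fun_eq_iff)

locale finite_dual = finite_dimensional_vector_space scl Basis
  for scl :: "'k::field \<Rightarrow> 'a::ab_group_add \<Rightarrow> 'a" and Basis :: "'a set"
begin

abbreviation lin :: "('a \<Rightarrow> 'a) \<Rightarrow> bool" where "lin \<equiv> Vector_Spaces.linear scl scl"

lemma lin_iff: "lin f \<longleftrightarrow> (\<forall>x y. f (x + y) = f x + f y) \<and> (\<forall>c x. f (scl c x) = scl c (f x))"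
  using vector_space_axioms by (simp add: Vector_Spaces.linear_iff)

lemma lin_simps:
  assumes "lin f"
  shows "f (x + y) = f x + f y" "f (scl c x) = scl c (f x)" "f 0 = 0" "f (- x) = - f x"
    "f (x - y) = f x - f y"
proof -
  interpret f: Vector_Spaces.linear scl scl f by (rule assms)
  show "f (x + y) = f x + f y" "f (scl c x) = scl c (f x)" "f 0 = 0" "f (- x) = - f x"
    "f (x - y) = f x - f y"
    by (simp_all add: f.add f.scale f.neg f.diff)
qed

lemma dual_iff:
  "\<zeta> \<in> dual scl \<longleftrightarrow> (\<forall>x y. \<zeta> (x + y) = \<zeta> x + \<zeta> y) \<and> (\<forall>c x. \<zeta> (scl c x) = c * \<zeta> x)"
  using vector_space_axioms
  by (simp add: dual_def Vector_Spaces.linear_iff vector_space_mult[where 'b = 'k])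

lemma dual_simps:
  assumes "\<zeta> \<in> dual scl"
  shows "\<zeta> (x + y) = \<zeta> x + \<zeta> y" "\<zeta> (scl c x) = c * \<zeta> x" "\<zeta> 0 = 0" "\<zeta> (- x) = - \<zeta> x"
    "\<zeta> (x - y) = \<zeta> x - \<zeta> y" "\<zeta> (\<Sum>i\<in>I. f i) = (\<Sum>i\<in>I. \<zeta> (f i))"
proof -
  interpret f: Vector_Spaces.linear scl "(*)" \<zeta> using assms by (simp add: dual_def)
  show "\<zeta> (x + y) = \<zeta> x + \<zeta> y" "\<zeta> (scl c x) = c * \<zeta> x" "\<zeta> 0 = 0" "\<zeta> (- x) = - \<zeta> x"
    "\<zeta> (x - y) = \<zeta> x - \<zeta> y" "\<zeta> (\<Sum>i\<in>I. f i) = (\<Sum>i\<in>I. \<zeta> (f i))"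
    by (simp_all add: f.add f.scale f.neg f.diff f.sum)
qed

lemma coordinate_in_dual: "(\<lambda>x. representation Basis x b) \<in> dual scl"
  using independent_Basis span_Basis
  by (auto simp: dual_iff representation_add representation_scale)

lemma coordinate_expansion: "x = (\<Sum>b\<in>Basis. scl (representation Basis x b) b)"
  using sum_representation_eq[OF independent_Basis _ finite_Basis order_refl, of x]
  by (simp add: span_Basis)

lemma dual_separates:
  assumes "\<And>\<zeta>. \<zeta> \<in> dual scl \<Longrightarrow> \<zeta> x = \<zeta> y"
  shows "x = y"
  by (subst (1 2) coordinate_expansion) (simp add: assms[OF coordinate_in_dual])

lemma dual_eqI:
  assumes "\<zeta> \<in> dual scl" "\<eta> \<in> dual scl" "\<And>b. b \<in> Basis \<Longrightarrow> \<zeta> b = \<eta> b"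
  shows "\<zeta> = \<eta>"
proof
  fix x show "\<zeta> x = \<eta> x"
    by (subst (1 2) coordinate_expansion) (simp add: dual_simps assms)
qed

lemma T_op_eqI:
  assumes "\<And>\<eta>. \<eta> \<in> dual scl \<Longrightarrow> s \<zeta> \<eta> = \<eta> x"
  shows "T_op scl s \<zeta> = x"
  unfolding T_op_def by (rule the_equality) (auto simp: assms intro: dual_separates)

lemma T_op_tensor_sum:
  assumes "\<zeta> \<in> dual scl"
  shows "T_op scl (tensor_sum scl n a b) \<zeta> = (\<Sum>i<n. scl (\<zeta> (a i)) (b i))"
  by (rule T_op_eqI) (simp add: assms tensor_sum_apply dual_simps)

lemma tensor_sum_outside:
  "\<not> (\<zeta> \<in> dual scl \<and> \<eta> \<in> dual scl) \<Longrightarrow> tensor_sum scl n a b \<zeta> \<eta> = 0"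
  by (auto simp: tensor_sum_def sum_fun2_apply tensor_def intro: sum.neutral)

lemma sum_tensor_in_tensor_square:
  assumes "finite I"
  shows "(\<Sum>i\<in>I. tensor scl (a i) (b i)) \<in> tensor_square scl"
proof -
  obtain h where h: "bij_betw h {0..<card I} I" using ex_bij_betw_nat_finite[OF assms] by blast
  have "(\<Sum>i\<in>I. tensor scl (a i) (b i)) = tensor_sum scl (card I) (a \<circ> h) (b \<circ> h)"
    unfolding tensor_sum_def lessThan_atLeast0
    by (simp add: sum.reindex_bij_betw[OF h, where g = "\<lambda>i. tensor scl (a i) (b i)"])
  then show ?thesis unfolding tensor_square_def by blast
qed

end

section \<open>Tensors as operators, via a non-degenerate symmetric form\<close>

locale symmetric_form = finite_dual scl Basis
  for scl :: "'k::field \<Rightarrow> 'a::ab_group_add \<Rightarrow> 'a" and Basis :: "'a set" +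
  fixes \<omega> :: "'a \<Rightarrow> 'a \<Rightarrow> 'k"
  assumes form: "bilinear_form scl \<omega>" and nondeg: "nondegenerate \<omega>"
    and form_sym: "\<omega> x y = \<omega> y x"
begin

lemma form_right_in_dual: "\<omega> x \<in> dual scl"
  using form by (auto simp: dual_def bilinear_form_def)

lemma form_simps:
  "\<omega> x (y + z) = \<omega> x y + \<omega> x z" "\<omega> (x + y) z = \<omega> x z + \<omega> y z"
  "\<omega> x (scl c y) = c * \<omega> x y" "\<omega> (scl c x) y = c * \<omega> x y"
  "\<omega> x (- y) = - \<omega> x y" "\<omega> (- x) y = - \<omega> x y"
  "\<omega> x (y - z) = \<omega> x y - \<omega> x z" "\<omega> (x - y) z = \<omega> x z - \<omega> y z"
  "\<omega> x (\<Sum>i\<in>I. f i) = (\<Sum>i\<in>I. \<omega> x (f i))" "\<omega> (\<Sum>i\<in>I. f i) x = (\<Sum>i\<in>I. \<omega> (f i) x)"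
proof -
  note right = dual_simps[OF form_right_in_dual]
  show "\<omega> x (y + z) = \<omega> x y + \<omega> x z" "\<omega> x (scl c y) = c * \<omega> x y" "\<omega> x (- y) = - \<omega> x y"
    "\<omega> x (y - z) = \<omega> x y - \<omega> x z" "\<omega> x (\<Sum>i\<in>I. f i) = (\<Sum>i\<in>I. \<omega> x (f i))"
    by (fact right)+
  show "\<omega> (x + y) z = \<omega> x z + \<omega> y z" "\<omega> (scl c x) y = c * \<omega> x y" "\<omega> (- x) y = - \<omega> x y"
    "\<omega> (x - y) z = \<omega> x z - \<omega> y z" 
    using right by (metis form_sym)+
  show "\<omega> (\<Sum>i\<in>I. f i) x = (\<Sum>i\<in>I. \<omega> (f i) x)"
    using right(6)[of x f I] by (simp only: form_sym[of _ x])
qed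

lemma form_eqI: "(\<And>z. \<omega> x z = \<omega> y z) \<Longrightarrow> x = y"
  using nondeg[unfolded nondegenerate_def] form_simps(8)[of x y] by (metis diff_self eq_iff_diff_eq_0)

text \<open>
  Surjectivity: \<open>\<omega>\<^sup>\<sharp>\<close> followed by \<open>\<zeta> \<mapsto> \<Sum>\<^sub>b \<zeta>(b) b\<close>, the identification of \<open>A*\<close> with \<open>A\<close> that sends
  the dual basis to the basis, is an injective endomorphism of \<open>A\<close>, hence surjective.
\<close>

lemma sharp_bij: "bij_betw (sharp \<omega>) UNIV (dual scl)"
proof (rule bij_betw_imageI)
  show "inj (sharp \<omega>)"
    by (rule injI, rule form_eqI) (simp add: sharp_def fun_eq_iff)
  define \<Phi> where "\<Phi> x = (\<Sum>b\<in>Basis. scl (\<omega> x b) b)" for x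
  have "lin \<Phi>"
    by (auto simp: lin_iff \<Phi>_def form_simps scale_left_distrib sum.distrib scale_sum_right)
  then interpret \<Phi>: Vector_Spaces.linear scl scl \<Phi> .
  have coords: "f b = g b" if "(\<Sum>b\<in>Basis. scl (f b) b) = (\<Sum>b\<in>Basis. scl (g b) b)" "b \<in> Basis"
    for f g b
  proof -
    have "(\<Sum>b\<in>Basis. scl (f b - g b) b) = 0"
      using that(1) by (simp add: scale_left_diff_distrib sum_subtractf)
    then show ?thesis
      using independentD[OF independent_Basis finite_Basis order_refl, of "\<lambda>b. f b - g b"] that(2)
      by simp
  qed
  have "inj \<Phi>"
  proof (rule injI)
    fix x y assume "\<Phi> x = \<Phi> y"
    then have "\<omega> x b = \<omega> y b" if "b \<in> Basis" for b
      using coords[of "\<omega> x" "\<omega> y"] that by (simp add: \<Phi>_def)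
    then show "x = y"
      using dual_eqI[OF form_right_in_dual[of x] form_right_in_dual[of y]] by (metis form_eqI)
  qed
  then have "surj \<Phi>"
    by (rule linear_inj_imp_surj[OF \<open>lin \<Phi>\<close>])
  have "\<zeta> \<in> range (sharp \<omega>)" if \<zeta>: "\<zeta> \<in> dual scl" for \<zeta>
  proof -
    obtain x where "\<Phi> x = (\<Sum>b\<in>Basis. scl (\<zeta> b) b)" using \<open>surj \<Phi>\<close> by (metis surjD)
    then have "\<omega> x b = \<zeta> b" if "b \<in> Basis" for b
      using coords[of "\<omega> x" \<zeta>] that by (simp add: \<Phi>_def)
    then have "sharp \<omega> x = \<zeta>"
      using dual_eqI[OF form_right_in_dual \<zeta>] by (simp add: sharp_def)
    then show ?thesis by blast
  qed
  then show "range (sharp \<omega>) = dual scl"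
    using form_right_in_dual by (auto simp: sharp_def)
qed

definition flat :: "('a \<Rightarrow> 'k) \<Rightarrow> 'a" where
  "flat = inv_into UNIV (sharp \<omega>)"

lemma sharp_in_dual: "sharp \<omega> x \<in> dual scl"
  using form_right_in_dual by (simp add: sharp_def)

lemma flat_sharp: "flat (sharp \<omega> x) = x"
  using sharp_bij by (simp add: flat_def bij_betw_def)

lemma sharp_flat: "\<zeta> \<in> dual scl \<Longrightarrow> sharp \<omega> (flat \<zeta>) = \<zeta>"
  using sharp_bij by (auto simp: flat_def bij_betw_def f_inv_into_f)

lemma form_flat: "\<zeta> \<in> dual scl \<Longrightarrow> \<omega> (flat \<zeta>) x = \<zeta> x"
  using sharp_flat[of \<zeta>] by (simp add: sharp_def fun_eq_iff)

lemma flat_eqI: "\<zeta> = sharp \<omega> x \<Longrightarrow> flat \<zeta> = x"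
  by (simp add: flat_sharp)

lemma flat_add: "\<zeta> \<in> dual scl \<Longrightarrow> \<eta> \<in> dual scl \<Longrightarrow> flat (\<zeta> + \<eta>) = flat \<zeta> + flat \<eta>"
  and flat_scale: "\<zeta> \<in> dual scl \<Longrightarrow> flat (fun_scale c \<zeta>) = scl c (flat \<zeta>)"
  by (auto intro!: flat_eqI simp: fun_eq_iff sharp_def form_simps form_flat fun_scale_def)

text \<open>
  The tensor \<open>s\<close> with \<open>T_s = S \<circ> flat\<close>. It vanishes on functions that are not linear, as the
  elements of \<open>tensor_square\<close> do.
\<close>

definition op_tensor :: "('a \<Rightarrow> 'a) \<Rightarrow> ('a, 'k) tens2" where
  "op_tensor S = (\<lambda>\<zeta> \<eta>. if \<zeta> \<in> dual scl \<and> \<eta> \<in> dual scl then \<eta> (S (flat \<zeta>)) else 0)"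

lemma op_tensor_sharp: "op_tensor S (sharp \<omega> u) (sharp \<omega> v) = \<omega> v (S u)"
  by (simp add: op_tensor_def sharp_in_dual flat_sharp) (simp add: sharp_def)

lemma op_tensor_arith:
  "op_tensor S + op_tensor S' = op_tensor (\<lambda>u. S u + S' u)"
  "op_tensor S - op_tensor S' = op_tensor (\<lambda>u. S u - S' u)"
  "- op_tensor S = op_tensor (\<lambda>u. - S u)"
  "tens_scale c (op_tensor S) = op_tensor (\<lambda>u. scl c (S u))"
  "0 = op_tensor (\<lambda>u. 0)"
  by (auto simp: op_tensor_def fun_eq_iff dual_simps tens_scale_def)

definition adjoint :: "('a \<Rightarrow> 'a) \<Rightarrow> ('a \<Rightarrow> 'a) \<Rightarrow> bool" where
  "adjoint f f' \<longleftrightarrow> (\<forall>x y. \<omega> (f x) y = \<omega> x (f' y))"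

lemma flip_op_tensor:
  assumes "adjoint S S'"
  shows "flip (op_tensor S) = op_tensor S'"
proof (intro ext)
  fix \<zeta> \<eta>
  have "\<zeta> (S (flat \<eta>)) = \<eta> (S' (flat \<zeta>))" if "\<zeta> \<in> dual scl" "\<eta> \<in> dual scl"
    using assms form_flat[OF that(1)] form_flat[OF that(2)] form_sym by (metis adjoint_def)
  then show "flip (op_tensor S) \<zeta> \<eta> = op_tensor S' \<zeta> \<eta>"
    by (auto simp: flip_def op_tensor_def)
qed

lemma tmap_op_tensor:
  assumes "lin f" "lin g" "adjoint f f'"
  shows "tmap scl f g (op_tensor S) = op_tensor (\<lambda>u. g (S (f' u)))"
proof (intro ext)
  fix \<zeta> \<eta>
  have "flat (\<zeta> \<circ> f) = f' (flat \<zeta>)" if "\<zeta> \<in> dual scl"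
    by (rule flat_eqI, rule ext)
      (metis assms(3) adjoint_def form_flat[OF that] form_sym comp_apply sharp_def)
  then show "tmap scl f g (op_tensor S) \<zeta> \<eta> = op_tensor (\<lambda>u. g (S (f' u))) \<zeta> \<eta>"
    by (auto simp: tmap_def op_tensor_def dual_comp[OF assms(1)] dual_comp[OF assms(2)])
qed

lemma T_op_op_tensor: "\<zeta> \<in> dual scl \<Longrightarrow> T_op scl (op_tensor S) \<zeta> = S (flat \<zeta>)"
  by (rule T_op_eqI) (simp add: op_tensor_def)

lemma op_tensor_T_op:
  assumes "r \<in> tensor_square scl"
  shows "r = op_tensor (\<lambda>u. T_op scl r (sharp \<omega> u))"
proof -
  obtain n a b where r: "r = tensor_sum scl n a b"
    using assms by (auto simp: tensor_square_def)
  show ?thesis unfolding r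
    by (intro ext)
      (simp add: op_tensor_def sharp_flat T_op_tensor_sum tensor_sum_apply dual_simps tensor_sum_outside)
qed

lemma lin_T_op_sharp:
  assumes "r \<in> tensor_square scl"
  shows "lin (\<lambda>u. T_op scl r (sharp \<omega> u))"
proof -
  obtain n a b where r: "r = tensor_sum scl n a b"
    using assms by (auto simp: tensor_square_def)
  show ?thesis unfolding r lin_iff
    by (simp add: T_op_tensor_sum sharp_in_dual)
      (simp add: sharp_def form_simps scale_left_distrib sum.distrib scale_sum_right)
qed

text \<open>
  If \<open>b'\<close> is the basis dual to \<open>b\<close> with respect to \<open>\<omega>\<close>, then \<open>S\<close> corresponds to \<open>\<Sum>\<^sub>b b' \<otimes> S b\<close>,
  because \<open>u = \<Sum>\<^sub>b \<omega>(u, b') b\<close>.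
\<close>

lemma op_tensor_in_tensor_square:
  assumes "lin S"
  shows "op_tensor S \<in> tensor_square scl"
proof -
  interpret S: Vector_Spaces.linear scl scl S by (rule assms)
  define b' where "b' b = flat (\<lambda>x. representation Basis x b)" for b
  have b': "\<omega> (b' b) x = representation Basis x b" for b x
    by (simp add: b'_def form_flat coordinate_in_dual)
  have S: "S u = (\<Sum>b\<in>Basis. scl (\<omega> u (b' b)) (S b))" for u
    by (subst coordinate_expansion[of u]) (simp add: S.sum S.scale form_sym[of u] b')
  have "op_tensor S = (\<Sum>b\<in>Basis. tensor scl (b' b) (S b))"
  proof (intro ext)
    fix \<zeta> \<eta>
    show "op_tensor S \<zeta> \<eta> = (\<Sum>b\<in>Basis. tensor scl (b' b) (S b)) \<zeta> \<eta>"
    proof (cases "\<zeta> \<in> dual scl \<and> \<eta> \<in> dual scl")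
      case True
      then show ?thesis
        by (simp add: op_tensor_def sum_fun2_apply tensor_def)
          (subst S, simp add: dual_simps form_flat)
    next
      case False
      then show ?thesis by (auto simp: op_tensor_def sum_fun2_apply tensor_def intro: sum.neutral)
    qed
  qed
  then show ?thesis by (simp add: sum_tensor_in_tensor_square finite_Basis)
qed

lemma linear_op_tensor:
  assumes "\<And>x y. D (x + y) = (\<lambda>u. D x u + D y u)" "\<And>c x. D (scl c x) = (\<lambda>u. scl c (D x u))"
  shows "Vector_Spaces.linear scl tens_scale (\<lambda>x. op_tensor (D x))"
proof -
  have "vector_space (tens_scale :: 'k \<Rightarrow> ('a, 'k) tens2 \<Rightarrow> _)"
    by unfold_locales (auto simp: tens_scale_def fun_eq_iff algebra_simps)
  then show ?thesis
    using vector_space_axioms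
    by (simp add: Vector_Spaces.linear_iff op_tensor_arith assms)
qed

end


lemma bilinear_op_sum:
  assumes "vector_space scl" "bilinear_op_on scl UNIV m"
  shows "m (\<Sum>i\<in>I. scl (f i) (x i)) (\<Sum>j\<in>J. scl (g j) (y j)) =
    (\<Sum>i\<in>I. \<Sum>j\<in>J. scl (f i * g j) (m (x i) (y j)))"
proof -
  interpret vector_space scl by (rule assms(1))
  note op = bilinear_op_simps[OF assms(2)]
  have l: "m (\<Sum>i\<in>I. z i) w = (\<Sum>i\<in>I. m (z i) w)" for z w
    using op(1,7)[of 0 0] by (induction I rule: infinite_finite_induct) (simp_all add: op(1))
  have r: "m w (\<Sum>i\<in>J. z i) = (\<Sum>i\<in>J. m w (z i))" for z w
    using op(2,8)[of _ 0 0] by (induction J rule: infinite_finite_induct) (simp_all add: op(2))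
  show ?thesis unfolding l by (simp only: r op(3,4) scale_scale mult.commute)
qed

section \<open>Multiplication operators of a quadratic anti-pre-Poisson algebra\<close>

locale quadratic_APP = symmetric_form scl Basis \<omega>
  for scl :: "'k::field \<Rightarrow> 'a::ab_group_add \<Rightarrow> 'a" and Basis :: "'a set" and \<omega> +
  fixes ast circ :: "'a \<Rightarrow> 'a \<Rightarrow> 'a"
  assumes app: "anti_pre_Poisson scl ast circ"
    and form_ast: "\<omega> (ast x y) z = - \<omega> y (star ast x z)"
    and form_circ: "\<omega> (circ x y) z = \<omega> y (bracket circ x z)"
begin

lemma bilinear_ops:
  "bilinear_op_on scl UNIV ast" "bilinear_op_on scl UNIV circ"
  "bilinear_op_on scl UNIV (star ast)" "bilinear_op_on scl UNIV (bracket circ)"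
proof -
  show op: "bilinear_op_on scl UNIV ast" "bilinear_op_on scl UNIV circ"
    using app by (simp_all add: anti_pre_Poisson_on_def anti_Zinbiel_on_def anti_pre_Lie_on_def)
  note op_simps = bilinear_op_simps[OF op(1)] bilinear_op_simps[OF op(2)]
  show "bilinear_op_on scl UNIV (star ast)" "bilinear_op_on scl UNIV (bracket circ)"
    unfolding bilinear_op_on_def
    by (simp_all add: star_def bracket_def op_simps algebra_simps)
qed

lemmas op_simps = bilinear_ops[THEN bilinear_op_simps(1)] bilinear_ops[THEN bilinear_op_simps(2)]
  bilinear_ops[THEN bilinear_op_simps(3)] bilinear_ops[THEN bilinear_op_simps(4)]
  bilinear_ops[THEN bilinear_op_simps(5)] bilinear_ops[THEN bilinear_op_simps(6)]
  bilinear_ops[THEN bilinear_op_simps(7)] bilinear_ops[THEN bilinear_op_simps(8)]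

lemma Zinbiel:
  "ast x (ast y z) = - ast (star ast x y) z"
  "ast x (ast y z) = ast z (ast y x)"
  "ast x (ast y z) = ast y (ast x z)"
proof -
  have Z: "ast x (ast y z) = - ast (ast x y + ast y x) z \<and>
        - ast (ast x y + ast y x) z = - ast (ast z y + ast y z) x \<and>
        - ast (ast z y + ast y z) x = ast z (ast y x) \<and>
        ast z (ast x y) = ast x (ast z y)" for x y z
    using app unfolding anti_pre_Poisson_on_def anti_Zinbiel_on_def by blast
  show "ast x (ast y z) = - ast (star ast x y) z" "ast x (ast y z) = ast z (ast y x)"
    using Z[of x y z] by (simp_all add: star_def)
  show "ast x (ast y z) = ast y (ast x z)" using Z[of y z x] by simp
qed

lemma pre_Lie:
  "circ z (circ x y) = circ x (circ z y) + circ (bracket circ x z) y"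
  "circ (bracket circ x y) z + circ (bracket circ y z) x + circ (bracket circ z x) y = 0"
proof -
  have L: "circ x (circ y z) - circ y (circ x z) = circ (bracket circ y x) z \<and>
        circ (bracket circ x y) z + circ (bracket circ y z) x + circ (bracket circ z x) y = 0" for x y z
    using app unfolding anti_pre_Poisson_on_def anti_pre_Lie_on_def by blast
  show "circ (bracket circ x y) z + circ (bracket circ y z) x + circ (bracket circ z x) y = 0"
    using L by blast
  show "circ z (circ x y) = circ x (circ z y) + circ (bracket circ x z) y"
    using L[of z x y] by (simp add: algebra_simps)
qed

lemma pre_Poisson:
  "ast z (circ x y) = ast (bracket circ x z) y + circ x (ast z y)"
  "circ z (ast x y) = ast x (circ z y) + ast (bracket circ x z) y"
  "circ (star ast x y) z = - ast x (circ y z) - ast y (circ x z)"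
  "circ z (star ast x y) = ast x (circ z y) + ast y (circ z x) - ast x (circ y z) - ast y (circ x z)"
proof -
  have PP: "ast (circ x y - circ y x) z = ast y (circ x z) - circ x (ast y z)"
    "circ (ast x y + ast y x) z = - ast x (circ y z) - ast y (circ x z)"
    "circ z (ast x y + ast y x) + ast x (circ y z) + ast y (circ x z)
          = ast x (circ z y) + ast y (circ z x)" for x y z
    using app unfolding anti_pre_Poisson_on_def by blast+
  show "ast z (circ x y) = ast (bracket circ x z) y + circ x (ast z y)"
    using PP(1)[of x z y] by (simp add: bracket_def)
  show "circ z (ast x y) = ast x (circ z y) + ast (bracket circ x z) y"
    using PP(1)[of z x y] by (simp add: bracket_def op_simps algebra_simps)
  show "circ (star ast x y) z = - ast x (circ y z) - ast y (circ x z)"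
    using PP(2)[of x y z] by (simp add: star_def)
  show "circ z (star ast x y) = ast x (circ z y) + ast y (circ z x) - ast x (circ y z) - ast y (circ x z)"
    using PP(3)[of z x y] by (simp add: star_def algebra_simps)
qed

lemma star_commute: "star ast x y = star ast y x"
  by (simp add: star_def add.commute)

lemma bracket_anticommute: "bracket circ x y = - bracket circ y x"
  by (simp add: bracket_def)

text \<open>
  The value \<open>x \<ast> (y \<ast> z)\<close> is symmetric in its three arguments, and \<open>(x \<star> y) \<ast> z\<close> is its
  negative. Hence \<open>(x \<star> y) \<star> z\<close>, which has one summand of the second form and two of the first,
  equals \<open>x \<ast> (y \<ast> z)\<close> as well.
\<close>

lemma star_assoc: "star ast (star ast x y) z = star ast x (star ast y z)"
proof -
  have "star ast (star ast x y) z = ast x (ast y z)" for x y z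
  proof -
    have "star ast (star ast x y) z = - ast x (ast y z) + (ast z (ast x y) + ast z (ast y x))"
      using Zinbiel(1)[of x y z] by (subst star_def) (simp add: op_simps star_def[of ast x y])
    moreover have "ast z (ast x y) = ast x (ast y z)" "ast z (ast y x) = ast x (ast y z)"
      using Zinbiel(2,3) by metis+
    ultimately show ?thesis by simp
  qed
  note this[of x y z] this[of y z x]
  moreover have "ast y (ast z x) = ast x (ast y z)" using Zinbiel(2,3) by metis
  ultimately show ?thesis by (simp add: star_commute[of x])
qed

lemma Jacobi: "bracket circ (bracket circ x y) z =
    bracket circ x (bracket circ y z) - bracket circ y (bracket circ x z)"
proof -
  have "circ u (bracket circ v w) = circ u (circ v w) - circ u (circ w v)" for u v w
    by (simp add: bracket_def op_simps)
  moreover have "circ (bracket circ y x) z = - circ (bracket circ x y) z"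
    "circ (bracket circ z x) y = - circ (bracket circ x z) y"
    by (simp_all add: bracket_def op_simps)
  moreover from this(2) have "circ (bracket circ x y) z = circ (bracket circ x z) y - circ (bracket circ y z) x"
    using pre_Lie(2)[of x y z] by (simp add: algebra_simps)
  ultimately show ?thesis
    by (simp add: bracket_def[of circ "bracket circ x y"] bracket_def[of circ x "bracket circ y z"]
        bracket_def[of circ y "bracket circ x z"]
        pre_Lie(1)[of z x y] pre_Lie(1)[of z y x] pre_Lie(1)[of x y z])
qed

lemma Leibniz: "bracket circ x (star ast y z) = star ast (bracket circ x y) z + star ast y (bracket circ x z)"
proof -
  have "bracket circ x (star ast y z) = ast y (circ x z) + ast z (circ x y)"
    by (simp add: bracket_def pre_Poisson(3,4))
  moreover have "ast (bracket circ x y) z + ast (bracket circ x z) y =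
      ast y (circ x z) + ast z (circ x y) - circ x (star ast y z)"
    using pre_Poisson(1)[of y x z] pre_Poisson(1)[of z x y] by (simp add: star_def op_simps algebra_simps)
  then have "ast (bracket circ x y) z + ast (bracket circ x z) y = ast y (circ z x) + ast z (circ y x)"
    by (simp add: pre_Poisson(4))
  moreover have "ast z (bracket circ x y) + ast y (bracket circ x z) =
      ast z (circ x y) - ast z (circ y x) + ast y (circ x z) - ast y (circ z x)"
    by (simp add: bracket_def op_simps)
  ultimately show ?thesis by (simp add: star_def algebra_simps)
qed

lemma lin_ops:
  "lin (Lop ast x)" "lin (Rop ast x)" "lin (Lop circ x)" "lin (Rop circ x)"
  "lin (Lstar ast x)" "lin (adop circ x)" "lin id"
  by (simp_all add: lin_iff Lop_def Rop_def Lstar_def adop_def op_simps algebra_simps)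

lemma Lstar_eq: "Lstar ast x = star ast x" and adop_eq: "adop circ x = bracket circ x"
  by (simp_all add: fun_eq_iff Lstar_def adop_def Lop_def Rop_def star_def bracket_def)

text \<open>
  The adjoints of the right multiplications follow from \<open>R_\<ast> = L_\<star> - L_\<ast>\<close> and \<open>R_\<circ> = L_\<circ> - ad\<close>, as
  invariance of \<open>\<omega>\<close> makes \<open>L_\<ast>\<close> and \<open>- L_\<star>\<close>, and \<open>L_\<circ>\<close> and \<open>ad\<close>, adjoint to each other.
\<close>

lemma form_ast_right: "\<omega> (ast x y) z = \<omega> x (ast z y)"
proof -
  have "\<omega> (ast x y) z + \<omega> (ast y x) z = \<omega> (star ast y x) z" by (simp add: star_def form_simps)
  also have "\<dots> = - \<omega> (ast y z) x" using form_ast[of y z x] form_sym by simp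
  finally have "\<omega> (ast x y) z = - \<omega> (ast y z) x - \<omega> (ast y x) z" by (simp add: algebra_simps)
  also have "\<omega> (ast y x) z = - \<omega> x (ast y z + ast z y)" by (simp add: form_ast star_def)
  also have "- \<omega> (ast y z) x - - \<omega> x (ast y z + ast z y) = \<omega> x (ast z y)"
    by (simp add: form_simps form_sym[of _ x])
  finally show ?thesis .
qed

lemma form_circ_right: "\<omega> (circ x y) z = - \<omega> x (circ z y)"
proof -
  have "\<omega> (circ y z) x = \<omega> z (circ y x - circ x y)" by (simp add: form_circ bracket_def)
  moreover have "\<omega> (circ z y) x = \<omega> y (circ z x - circ x z)" by (simp add: form_circ bracket_def)
  moreover have "\<omega> (circ y x) z = \<omega> x (circ y z - circ z y)" by (simp add: form_circ bracket_def)
  ultimately show ?thesis by (simp add: form_simps form_sym[of _ z] form_sym[of _ x])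
qed

lemma adjoint_ops:
  "adjoint (Lop ast x) (\<lambda>u. - star ast x u)" "adjoint (Rop ast x) (\<lambda>u. ast u x)"
  "adjoint (Lop circ x) (\<lambda>u. bracket circ x u)" "adjoint (Rop circ x) (\<lambda>u. - circ u x)"
  "adjoint id (\<lambda>u. u)"
  unfolding adjoint_def Lop_def Rop_def
  by (simp_all only: form_simps form_ast form_circ id_apply)
    (simp_all only: form_ast_right[symmetric] form_circ_right[symmetric] form_ast[symmetric]
      form_circ[symmetric] simp_thms)

lemma tmap_ops:
  "tmap scl (Lop ast x) id (op_tensor S) = op_tensor (\<lambda>u. S (- star ast x u))"
  "tmap scl (Rop ast x) id (op_tensor S) = op_tensor (\<lambda>u. S (ast u x))"
  "tmap scl (Lop circ x) id (op_tensor S) = op_tensor (\<lambda>u. S (bracket circ x u))"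
  "tmap scl (Rop circ x) id (op_tensor S) = op_tensor (\<lambda>u. S (- circ u x))"
  "tmap scl id (Lop ast x) (op_tensor S) = op_tensor (\<lambda>u. ast x (S u))"
  "tmap scl id (Rop ast x) (op_tensor S) = op_tensor (\<lambda>u. ast (S u) x)"
  "tmap scl id (Lop circ x) (op_tensor S) = op_tensor (\<lambda>u. circ x (S u))"
  "tmap scl id (Rop circ x) (op_tensor S) = op_tensor (\<lambda>u. circ (S u) x)"
  "tmap scl id (Lstar ast x) (op_tensor S) = op_tensor (\<lambda>u. star ast x (S u))"
  "tmap scl id (adop circ x) (op_tensor S) = op_tensor (\<lambda>u. bracket circ x (S u))"
  by (simp_all add: tmap_op_tensor[OF lin_ops(1) lin_ops(7) adjoint_ops(1)]
      tmap_op_tensor[OF lin_ops(2) lin_ops(7) adjoint_ops(2)]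
      tmap_op_tensor[OF lin_ops(3) lin_ops(7) adjoint_ops(3)]
      tmap_op_tensor[OF lin_ops(4) lin_ops(7) adjoint_ops(4)]
      tmap_op_tensor[OF lin_ops(7) _ adjoint_ops(5)] lin_ops)
    (simp_all add: Lop_def Rop_def Lstar_eq adop_eq)


section \<open>The Yang-Baxter equation in operator form\<close>

text \<open>
  For \<open>r = \<Sum>\<^sub>i a\<^sub>i \<otimes> b\<^sub>i\<close> one has \<open>P u = \<Sum>\<^sub>i \<omega>(u, a\<^sub>i) b\<^sub>i\<close> and \<open>P* w = \<Sum>\<^sub>i \<omega>(w, b\<^sub>i) a\<^sub>i\<close>, so each of the
  three terms of the equation is a product of values of \<open>P\<close> or \<open>P*\<close>, paired with the argument in the
  tensor factor where the product stands. Adjunction moves that pairing to \<open>v\<close> in all three.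
\<close>

lemma YBE_at:
  assumes r: "tensor_sum scl n a b = op_tensor P" and adj: "adjoint P P'"
  shows "APP_D scl ast n a b (sharp \<omega> u) (sharp \<omega> v) (sharp \<omega> w) =
      \<omega> v (ast (P u) (P' w) - P (ast u (P' w)) - P' (ast (P u) w))"
    and "APP_S scl circ n a b (sharp \<omega> u) (sharp \<omega> v) (sharp \<omega> w) =
      \<omega> v (circ (P u) (P' w) - P (circ u (P' w)) - P' (circ (P u) w))"
proof -
  have val: "(\<Sum>i<n. \<omega> u (a i) * \<omega> v (b i)) = \<omega> v (P u)" for u v
    using op_tensor_sharp[of P u v] unfolding r[symmetric]
    by (simp add: tensor_sum_apply sharp_in_dual) (simp add: sharp_def)
  have P: "P u = (\<Sum>i<n. scl (\<omega> u (a i)) (b i))" for u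
    by (rule form_eqI) (simp add: form_sym[of "P u"] val[symmetric] form_simps form_sym[of "b _"])
  have P': "P' u = (\<Sum>i<n. scl (\<omega> u (b i)) (a i))" for u
  proof (rule form_eqI)
    fix z
    have "\<omega> (P' u) z = \<omega> u (P z)" using adj unfolding adjoint_def by (metis form_sym)
    then show "\<omega> (P' u) z = \<omega> (\<Sum>i<n. scl (\<omega> u (b i)) (a i)) z"
      by (simp add: val[symmetric] form_simps form_sym[of "a _"] mult.commute)
  qed
  have PP: "\<omega> z (m (P u) (P v)) = (\<Sum>i<n. \<Sum>j<n. \<omega> u (a i) * \<omega> v (a j) * \<omega> z (m (b i) (b j)))"
    and PP': "\<omega> z (m (P u) (P' v)) = (\<Sum>i<n. \<Sum>j<n. \<omega> u (a i) * \<omega> v (b j) * \<omega> z (m (b i) (a j)))"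
    and P'P': "\<omega> z (m (P' u) (P' v)) = (\<Sum>i<n. \<Sum>j<n. \<omega> u (b i) * \<omega> v (b j) * \<omega> z (m (a i) (a j)))"
    if "bilinear_op_on scl UNIV m" for m u v z
    unfolding P P' by (simp_all add: bilinear_op_sum[OF vector_space_axioms that] form_simps)
  have adj': "\<omega> (P x) y = \<omega> x (P' y)" "\<omega> (P' x) y = \<omega> x (P y)" for x y
    using adj form_sym by (metis adjoint_def)+
  have "APP_D scl ast n a b (sharp \<omega> u) (sharp \<omega> v) (sharp \<omega> w) =
      \<omega> v (ast (P u) (P' w)) - \<omega> u (ast (P' v) (P' w)) + \<omega> w (star ast (P u) (P v))"
    by (simp add: APP_D_def sum_fun3_apply tensor3_def sharp_in_dual)
      (simp add: sharp_def PP PP' P'P' bilinear_ops sum.distrib sum_subtractf algebra_simps)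
  moreover have "\<omega> u (ast (P' v) (P' w)) = \<omega> v (P (ast u (P' w)))"
    by (metis form_ast_right adj' form_sym)
  moreover have "\<omega> w (star ast (P u) (P v)) = - \<omega> v (P' (ast (P u) w))"
    by (metis form_ast adj' form_sym minus_minus)
  ultimately show "APP_D scl ast n a b (sharp \<omega> u) (sharp \<omega> v) (sharp \<omega> w) =
      \<omega> v (ast (P u) (P' w) - P (ast u (P' w)) - P' (ast (P u) w))"
    by (simp add: form_simps)
  have "APP_S scl circ n a b (sharp \<omega> u) (sharp \<omega> v) (sharp \<omega> w) =
      \<omega> u (circ (P' v) (P' w)) + \<omega> v (circ (P u) (P' w)) - \<omega> w (bracket circ (P u) (P v))"
    by (simp add: APP_S_def sum_fun3_apply tensor3_def sharp_in_dual)
      (simp add: sharp_def PP PP' P'P' bilinear_ops sum.distrib sum_subtractf algebra_simps)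
  moreover have "\<omega> u (circ (P' v) (P' w)) = - \<omega> v (P (circ u (P' w)))"
    by (metis form_circ_right adj' form_sym)
  moreover have "\<omega> w (bracket circ (P u) (P v)) = \<omega> v (P' (circ (P u) w))"
    by (metis form_circ adj' form_sym)
  ultimately show "APP_S scl circ n a b (sharp \<omega> u) (sharp \<omega> v) (sharp \<omega> w) =
      \<omega> v (circ (P u) (P' w) - P (circ u (P' w)) - P' (circ (P u) w))"
    by (simp add: form_simps)
qed

lemma tens3_eq_0_iff:
  assumes outside: "\<And>\<zeta> \<eta> \<theta>. \<not> (\<zeta> \<in> dual scl \<and> \<eta> \<in> dual scl \<and> \<theta> \<in> dual scl) \<Longrightarrow> t \<zeta> \<eta> \<theta> = (0 :: 'k)"
    and at: "\<And>u v w. t (sharp \<omega> u) (sharp \<omega> v) (sharp \<omega> w) = \<omega> v (E u w)"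
  shows "t = 0 \<longleftrightarrow> (\<forall>u w. E u w = 0)"
proof
  assume "t = 0"
  then have "\<omega> v (E u w) = 0" for u v w using at[of u v w] by simp
  then show "\<forall>u w. E u w = 0" using nondeg by (auto simp: nondegenerate_def)
next
  assume E: "\<forall>u w. E u w = 0"
  show "t = 0"
  proof (intro ext)
    fix \<zeta> \<eta> \<theta>
    show "t \<zeta> \<eta> \<theta> = 0 \<zeta> \<eta> \<theta>"
      using outside[of \<zeta> \<eta> \<theta>] at[of "flat \<zeta>" "flat \<eta>" "flat \<theta>"] E
      by (cases "\<zeta> \<in> dual scl \<and> \<eta> \<in> dual scl \<and> \<theta> \<in> dual scl") (auto simp: sharp_flat form_simps(3)[of _ 0, simplified])
  qed
qed

end

section \<open>The bialgebra defined by a skew operator\<close>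

locale quadratic_APP_skew = quadratic_APP scl Basis \<omega> ast circ
  for scl :: "'k::field \<Rightarrow> 'a::ab_group_add \<Rightarrow> 'a" and Basis :: "'a set" and \<omega> ast circ +
  fixes lam :: 'k and P :: "'a \<Rightarrow> 'a"
  assumes lin_P: "lin P"
    and skew: "\<omega> (P x) y + \<omega> x (P y) + lam * \<omega> x y = 0"
begin

lemmas P_simps = lin_simps[OF lin_P]

text \<open>
The adjoint of \<open>P\<close>.
\<close>

definition P' :: "'a \<Rightarrow> 'a" where "P' x = - P x - scl lam x"

lemma adjoint_P: "adjoint P P'"
proof (unfold adjoint_def, intro allI)
  fix x y
  have "\<omega> (P x) y = - (\<omega> x (P y) + lam * \<omega> x y)"
    using skew[of x y] by (simp only: eq_neg_iff_add_eq_0 add.assoc)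
  then show "\<omega> (P x) y = \<omega> x (P' y)" by (simp add: P'_def form_simps)
qed

lemma form_P: "\<omega> (P x) y = \<omega> x (P' y)" "\<omega> (P' x) y = \<omega> x (P y)"
  using adjoint_P form_sym by (metis adjoint_def)+

abbreviation r where "r \<equiv> op_tensor P"

lemma Delta_r_eq: "Delta_r scl ast r x = op_tensor (\<lambda>u. P (star ast x u) - star ast x (P u))"
  by (simp add: Delta_r_def tmap_ops op_tensor_arith P_simps)

lemma delta_r_eq: "delta_r scl circ r x = op_tensor (\<lambda>u. P (bracket circ x u) - bracket circ x (P u))"
  by (simp add: delta_r_def tmap_ops op_tensor_arith)

lemma flip_Delta_r: "flip (Delta_r scl ast r x) = op_tensor (\<lambda>u. ast x (P u) - P (ast x u))"
  unfolding Delta_r_eq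
proof (rule flip_op_tensor, unfold adjoint_def, intro allI)
  fix u v
  have "\<omega> (P (star ast x u)) v = - \<omega> u (ast x (P' v))"
    using form_ast[of x "P' v" u] by (simp add: form_P(1) form_sym[of "star ast x u"] form_sym[of u])
  moreover have "\<omega> (star ast x (P u)) v = - \<omega> u (P' (ast x v))"
    using form_ast[of x v "P u"] by (simp add: form_sym[of _ v] form_sym[of u] form_P(2))
  ultimately show "\<omega> (P (star ast x u) - star ast x (P u)) v = \<omega> u (ast x (P v) - P (ast x v))"
    by (simp add: form_simps P'_def op_simps)
qed

lemma flip_delta_r: "flip (delta_r scl circ r x) = op_tensor (\<lambda>u. P (circ x u) - circ x (P u))"
  unfolding delta_r_eq
proof (rule flip_op_tensor, unfold adjoint_def, intro allI)
  fix u v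
  have "\<omega> (P (bracket circ x u)) v = \<omega> u (circ x (P' v))"
    using form_circ[of x "P' v" u] by (simp add: form_P(1) form_sym[of "bracket circ x u"] form_sym[of u])
  moreover have "\<omega> (bracket circ x (P u)) v = \<omega> u (P' (circ x v))"
    using form_circ[of x v "P u"] by (simp add: form_sym[of _ v] form_sym[of u] form_P(2))
  ultimately show "\<omega> (P (bracket circ x u) - bracket circ x (P u)) v = \<omega> u (P (circ x v) - circ x (P v))"
    by (simp add: form_simps P'_def op_simps)
qed

text \<open>
  The rules \<open>flips\<close> come first: they push \<open>flip\<close> inwards to \<open>\<Delta>_r\<close> and \<open>\<delta>_r\<close>, whose flips are known
  operators only as long as \<open>\<Delta>_r\<close> and \<open>\<delta>_r\<close> are still folded. Then \<open>to_operators\<close> turns both sides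
  of an equation into a single operator.
\<close>

lemmas flips = flip_tmap flip_add flip_diff flip_minus flip_Delta_r flip_delta_r Let_def

lemmas to_operators = Delta_r_eq delta_r_eq tmap_ops op_tensor_arith

text \<open>
  In the order of the conditions, the operator identities to which \<open>[P, _]\<close> is applied are
  \<^item> \<open>L_\<star>(x \<star> y) = L_\<star>(x) L_\<star>(y)\<close>,
  \<^item> \<open>R_\<ast>(x \<ast> y) = - R_\<ast>(y) L_\<star>(x)\<close>,
  \<^item> \<open>ad([x, y]) = ad(x) ad(y) - ad(y) ad(x)\<close>,
  \<^item> \<open>R_\<circ>(x \<circ> y) = L_\<circ>(x) R_\<circ>(y) + R_\<circ>(y) ad(x)\<close>,
  \<^item> \<open>ad(x \<star> y) = L_\<star>(x) ad(y) + L_\<star>(y) ad(x)\<close>,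
  \<^item> \<open>L_\<star>([x, y]) = ad(x) L_\<star>(y) - L_\<star>(y) ad(x)\<close>,
  \<^item> \<open>R_\<ast>(x \<circ> y) = R_\<ast>(y) ad(x) + L_\<circ>(x) R_\<ast>(y)\<close>,
  \<^item> \<open>R_\<circ>(x \<ast> y) = L_\<ast>(x) R_\<circ>(y) + R_\<ast>(y) ad(x)\<close>.

  Each is used at \<open>u\<close> and at \<open>P u\<close>, as \<open>[P, X] u = P (X u) - X (P u)\<close>.
\<close>

lemma bialgebra_compatibilities:
  "Delta_r scl ast r (star ast x y) = tmap scl id (Lstar ast x) (Delta_r scl ast r y)
    - tmap scl (Lop ast y) id (Delta_r scl ast r x)" (is ?c1)
  "Delta_r scl ast r (ast x y) + flip (Delta_r scl ast r (ast x y))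
    = tmap scl (Lop ast x) id (Delta_r scl ast r y + flip (Delta_r scl ast r y))
      - tmap scl id (Rop ast y) (Delta_r scl ast r x)" (is ?c2)
  "delta_r scl circ r (bracket circ x y)
    = (tmap scl id (adop circ x) (delta_r scl circ r y) - tmap scl (Lop circ x) id (delta_r scl circ r y))
      - (tmap scl id (adop circ y) (delta_r scl circ r x) - tmap scl (Lop circ y) id (delta_r scl circ r x))" (is ?c3)
  "let s = delta_r scl circ r (circ x y) - tmap scl (Lop circ x) id (delta_r scl circ r y)
        - tmap scl id (Lop circ x) (delta_r scl circ r y) + tmap scl id (Rop circ y) (delta_r scl circ r x)
    in s - flip s = 0" (is ?c4)
  "delta_r scl circ r (star ast x y)
    = tmap scl id (Lstar ast x) (delta_r scl circ r y) + tmap scl id (Lstar ast y) (delta_r scl circ r x)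
      + tmap scl (Lop circ x) id (Delta_r scl ast r y) + tmap scl (Lop circ y) id (Delta_r scl ast r x)" (is ?c5)
  "Delta_r scl ast r (bracket circ x y)
    = - tmap scl (Lop circ x) id (Delta_r scl ast r y) - tmap scl id (Lstar ast y) (delta_r scl circ r x)
      - tmap scl (Lop ast y) id (delta_r scl circ r x) + tmap scl id (adop circ x) (Delta_r scl ast r y)" (is ?c6)
  "let s = tmap scl (Lop circ x) id (Delta_r scl ast r y) + tmap scl id (Lop circ x) (Delta_r scl ast r y)
        + tmap scl id (Rop ast y) (delta_r scl circ r x)
    in Delta_r scl ast r (circ x y) + flip (Delta_r scl ast r (circ x y)) = s + flip s" (is ?c7)
  "delta_r scl circ r (ast x y) - flip (delta_r scl circ r (ast x y))
    = tmap scl id (Lop ast x) (delta_r scl circ r y) - flip (tmap scl (Lop ast x) id (delta_r scl circ r y))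
      - tmap scl (Lop circ x) id (Delta_r scl ast r y) - flip (tmap scl id (Lop circ x) (Delta_r scl ast r y))
      - tmap scl id (Rop ast y) (delta_r scl circ r x) - flip (tmap scl id (Rop circ y) (Delta_r scl ast r x))" (is ?c8)
proof -
  have eqI: "op_tensor S = op_tensor S'" if "\<And>u. S u = S' u" for S S'
    using that by (intro arg_cong[where f = op_tensor] ext)
  note expand = star_def bracket_def op_simps P_simps algebra_simps
  show ?c1
    unfolding to_operators
    by (rule eqI) (simp add: star_assoc op_simps P_simps)
  show ?c2
    unfolding flips unfolding to_operators
  proof (rule eqI, goal_cases)
    case (1 u)
    have "ast u (ast x y) = - ast (star ast x u) y" for u
      using Zinbiel(1)[of u x y] by (simp add: star_commute)
    note E = this[of u] this[of "P u"]
    show ?case by (simp add: E expand)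
  qed
  show ?c3
    unfolding to_operators
    by (rule eqI) (simp add: Jacobi op_simps P_simps)
  show ?c4
    unfolding flips unfolding to_operators
  proof (rule eqI, goal_cases)
    case (1 u)
    note E = pre_Lie(1)[of u x y] pre_Lie(1)[of "P u" x y]
    show ?case by (simp add: E expand)
  qed
  have "bracket circ (star ast x y) u = star ast x (bracket circ y u) + star ast y (bracket circ x u)" for u
    using Leibniz[of u x y] 
    by (simp add: bracket_anticommute[of u] op_simps star_commute[of "bracket circ x u"])
       (simp add: bracket_anticommute[of "star ast x y" u] add.commute)
  then show ?c5
    unfolding to_operators
    by (intro eqI) (simp add: op_simps P_simps)
  have "star ast (bracket circ x y) u = bracket circ x (star ast y u) - star ast y (bracket circ x u)" for u
    using Leibniz[of x y u] by simp
  then show ?c6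
    unfolding to_operators
    by (intro eqI) (simp add: op_simps P_simps)
  show ?c7
    unfolding flips unfolding to_operators
  proof (rule eqI, goal_cases)
    case (1 u)
    note E = pre_Poisson(1)[of u x y] pre_Poisson(1)[of "P u" x y]
    show ?case by (simp add: E expand)
  qed
  show ?c8
    unfolding flips unfolding to_operators
  proof (rule eqI, goal_cases)
    case (1 u)
    note E = pre_Poisson(2)[of u x y] pre_Poisson(2)[of "P u" x y]
    show ?case by (simp add: E expand)
  qed
qed


lemma r_in_tensor_square: "r \<in> tensor_square scl"
  by (rule op_tensor_in_tensor_square[OF lin_P])

section \<open>The Rota-Baxter identities\<close>

lemma solves_APP_YBE_iff: "solves_APP_YBE scl ast circ r \<longleftrightarrow>
    Rota_Baxter scl lam ast P \<and> Rota_Baxter scl lam circ P"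
proof -
  have RB: "(\<forall>u w. m (P u) (P' w) - P (m u (P' w)) - P' (m (P u) w) = 0) \<longleftrightarrow> Rota_Baxter scl lam m P"
    if "bilinear_op_on scl UNIV m" for m
  proof -
    \<comment> \<open>Substitute \<open>P' = - P - \<lambda>\<close>; the terms \<open>\<lambda> (P u \<cdot> w)\<close> cancel.\<close>
    have "m (P u) (P' w) - P (m u (P' w)) - P' (m (P u) w) =
        P (m (P u) w + m u (P w) + scl lam (m u w)) - m (P u) (P w)" for u w
      unfolding P'_def by (simp add: bilinear_op_simps[OF that] P_simps)
    then show ?thesis unfolding Rota_Baxter_def by (simp only: right_minus_eq) metis
  qed
  have YBE: "APP_D scl ast n a b = 0 \<and> APP_S scl circ n a b = 0 \<longleftrightarrow>
      Rota_Baxter scl lam ast P \<and> Rota_Baxter scl lam circ P"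
    if "tensor_sum scl n a b = r" for n a b
    unfolding RB[OF bilinear_ops(1), symmetric] RB[OF bilinear_ops(2), symmetric]
    by (intro arg_cong2[where f = "(\<and>)"] tens3_eq_0_iff YBE_at[OF that adjoint_P])
      (auto simp: APP_D_def APP_S_def sum_fun3_apply tensor3_def intro!: sum.neutral)
  show ?thesis
    using r_in_tensor_square YBE unfolding solves_APP_YBE_def tensor_square_def by force
qed

lemma comultiplications:
  "comultiplication scl (Delta_r scl ast r)" "comultiplication scl (delta_r scl circ r)"
  unfolding comultiplication_def Delta_r_eq[abs_def] delta_r_eq[abs_def]
  by (safe intro!: linear_op_tensor op_tensor_in_tensor_square,
      simp_all add: lin_iff fun_eq_iff P_simps op_simps scale_right_diff_distrib)

text \<open>
  The right-hand sides arise as \<open>P u \<cdot> v - u \<cdot> P* v\<close>.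
\<close>

lemma dual_ops_sharp:
  "dual_op (Delta_r scl ast r) (sharp \<omega> u) (sharp \<omega> v) =
    sharp \<omega> (ast (P u) v + ast u (P v) + scl lam (ast u v))"
  "dual_op (delta_r scl circ r) (sharp \<omega> u) (sharp \<omega> v) =
    sharp \<omega> (circ (P u) v + circ u (P v) + scl lam (circ u v))"
proof -
  have "\<omega> v (P (star ast x u)) = - \<omega> (ast u (P' v)) x"
    "\<omega> v (star ast x (P u)) = - \<omega> (ast (P u) v) x" for x
    by (simp_all add: form_ast form_P(2) star_commute[of x])
  moreover have "\<omega> v (P (bracket circ x u)) = - \<omega> (circ u (P' v)) x"
    "\<omega> v (bracket circ x (P u)) = - \<omega> (circ (P u) v) x" for x
    by (simp_all add: form_circ form_P(2) bracket_anticommute[of x] P_simps form_simps)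
  ultimately show "dual_op (Delta_r scl ast r) (sharp \<omega> u) (sharp \<omega> v) =
      sharp \<omega> (ast (P u) v + ast u (P v) + scl lam (ast u v))"
    "dual_op (delta_r scl circ r) (sharp \<omega> u) (sharp \<omega> v) =
      sharp \<omega> (circ (P u) v + circ u (P v) + scl lam (circ u v))"
    by (simp_all add: fun_eq_iff dual_op_def Delta_r_eq delta_r_eq op_tensor_sharp form_simps)
      (simp_all add: sharp_def form_simps P'_def op_simps)
qed

text \<open>
  For the products of \<open>dual_ops_sharp\<close>, the Rota-Baxter identity says that \<open>P\<close> is multiplicative, and
  implies that \<open>P + \<lambda>\<close> is. The difference of the two maps is the injective map \<open>\<lambda> I\<close>.
\<close>

lemma coalgebra:
  assumes lam: "lam \<noteq> 0"
    and RB: "Rota_Baxter scl lam ast P" "Rota_Baxter scl lam circ P"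
  shows "anti_pre_Poisson_coalgebra scl (Delta_r scl ast r) (delta_r scl circ r)"
proof -
  let ?Q = "\<lambda>x. P x + scl lam x"
  let ?F = "{\<lambda>\<zeta>. P (flat \<zeta>), \<lambda>\<zeta>. ?Q (flat \<zeta>)}"
  have dual_op_eq:
    "dual_op (Delta_r scl ast r) \<zeta> \<eta> = sharp \<omega> (ast (P (flat \<zeta>)) (flat \<eta>) +
      ast (flat \<zeta>) (P (flat \<eta>)) + scl lam (ast (flat \<zeta>) (flat \<eta>)))"
    "dual_op (delta_r scl circ r) \<zeta> \<eta> = sharp \<omega> (circ (P (flat \<zeta>)) (flat \<eta>) +
      circ (flat \<zeta>) (P (flat \<eta>)) + scl lam (circ (flat \<zeta>) (flat \<eta>)))"
    if "\<zeta> \<in> dual scl" "\<eta> \<in> dual scl" for \<zeta> \<eta>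
    using dual_ops_sharp[of "flat \<zeta>" "flat \<eta>"] that by (simp_all add: sharp_flat)
  have "anti_pre_Poisson_on fun_scale (dual scl) (dual_op (Delta_r scl ast r)) (dual_op (delta_r scl circ r))"
  proof (rule anti_pre_Poisson_on_jointly_embedded[OF app, where F = ?F])
    show "vector_space_on fun_scale (dual scl)"
      by (rule vector_space_on_dual[OF vector_space_axioms])
  next
    fix \<zeta> \<eta> assume mem: "\<zeta> \<in> dual scl" "\<eta> \<in> dual scl"
    show "dual_op (Delta_r scl ast r) \<zeta> \<eta> \<in> dual scl" "dual_op (delta_r scl circ r) \<zeta> \<eta> \<in> dual scl"
      using mem by (simp_all add: dual_op_eq sharp_in_dual)
    fix f assume "f \<in> ?F"
    then consider "f = (\<lambda>\<zeta>. P (flat \<zeta>))" | "f = (\<lambda>\<zeta>. ?Q (flat \<zeta>))" by blast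
    then show "f (\<zeta> + \<eta>) = f \<zeta> + f \<eta>"
      "f (dual_op (Delta_r scl ast r) \<zeta> \<eta>) = ast (f \<zeta>) (f \<eta>)"
      "f (dual_op (delta_r scl circ r) \<zeta> \<eta>) = circ (f \<zeta>) (f \<eta>)"
      using RB mem
      by (cases; simp add: flat_add dual_op_eq flat_sharp Rota_Baxter_def
          op_simps P_simps scale_right_distrib)+
  next
    fix f c \<zeta> assume "f \<in> ?F" "\<zeta> \<in> dual scl"
    then show "f (fun_scale c \<zeta>) = scl c (f \<zeta>)"
      by (auto simp: flat_scale P_simps scale_right_distrib scale_left_commute)
  next
    fix \<zeta> \<eta> assume mem: "\<zeta> \<in> dual scl" "\<eta> \<in> dual scl" and eq: "\<And>f. f \<in> ?F \<Longrightarrow> f \<zeta> = f \<eta>"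
    from eq[of "\<lambda>\<zeta>. P (flat \<zeta>)"] eq[of "\<lambda>\<zeta>. ?Q (flat \<zeta>)"] have "flat \<zeta> = flat \<eta>"
      using lam by simp
    then show "\<zeta> = \<eta>" by (metis mem sharp_flat)
  qed
  then show ?thesis by (simp add: anti_pre_Poisson_coalgebra_def comultiplications)
qed

lemma r_symmetrized: "r + flip r = op_tensor (\<lambda>u. - scl lam u)"
  unfolding flip_op_tensor[OF adjoint_P] op_tensor_arith by (simp add: P'_def)

lemma factorizable_r:
  assumes lam: "lam \<noteq> 0"
    and RB: "Rota_Baxter scl lam ast P" "Rota_Baxter scl lam circ P"
  shows "factorizable scl ast circ r"
  unfolding factorizable_def quasi_triangular_def
proof (intro conjI)
  show "r \<in> tensor_square scl" by (rule r_in_tensor_square)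
  show "solves_APP_YBE scl ast circ r" using RB by (simp add: solves_APP_YBE_iff)
  show "anti_pre_Poisson_bialgebra scl ast circ (Delta_r scl ast r) (delta_r scl circ r)"
    unfolding anti_pre_Poisson_bialgebra_def Let_def[of "tmap scl"] Let_def[of "Lop _"]
      Let_def[of "Rop _"] Let_def[of "adop circ"] Let_def[of "Lstar ast"]
    by (intro conjI allI app coalgebra[OF lam RB] bialgebra_compatibilities)
  show "tensor_invariant scl ast circ (r + flip r)"
    unfolding tensor_invariant_def r_symmetrized tmap_ops op_tensor_arith
    by (simp add: op_simps)
  have T: "T_op scl (r + flip r) \<zeta> = scl (- lam) (flat \<zeta>)" if "\<zeta> \<in> dual scl" for \<zeta>
    unfolding r_symmetrized by (simp add: T_op_op_tensor that)
  show "dual_linear_iso scl (T_op scl (r + flip r))"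
    unfolding dual_linear_iso_def
  proof (intro conjI ballI allI)
    interpret D: vector_space "fun_scale :: 'k \<Rightarrow> ('a \<Rightarrow> 'k) \<Rightarrow> _"
      using vector_space_on_dual[OF vector_space_axioms] by (simp add: vector_space_on_def)
    have sub: "D.subspace (dual scl)"
      using vector_space_on_dual[OF vector_space_axioms] by (simp add: vector_space_on_def)
    fix \<zeta> \<eta> c assume mem: "\<zeta> \<in> dual scl"
    then show "T_op scl (r + flip r) (fun_scale c \<zeta>) = scl c (T_op scl (r + flip r) \<zeta>)"
      by (simp add: T D.subspace_scale[OF sub] flat_scale mult.commute)
    assume "\<eta> \<in> dual scl"
    with mem show "T_op scl (r + flip r) (\<zeta> + \<eta>) = T_op scl (r + flip r) \<zeta> + T_op scl (r + flip r) \<eta>"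
      by (simp add: T D.subspace_add[OF sub] flat_add scale_right_distrib)
  next
    show "bij_betw (T_op scl (r + flip r)) (dual scl) UNIV"
    proof (rule bij_betw_byWitness[where f' = "\<lambda>x. sharp \<omega> (scl (- inverse lam) x)"])
    qed (use lam in \<open>auto simp: T flat_sharp sharp_in_dual sharp_flat\<close>)
  qed
qed

end

section \<open>From factorizable bialgebras to quadratic Rota-Baxter algebras and back\<close>

text \<open>
  The form \<open>\<omega>\<close> is \<open>- \<lambda>\<close> times the transport of the symmetric tensor \<open>t = r + \<tau>(r)\<close> to \<open>A\<close> along
  \<open>T_t\<close>. So \<open>\<omega>\<close> is symmetric, the invariance of \<open>t\<close> makes it invariant, and the operator corresponding
  to \<open>t\<close> is \<open>- \<lambda> I\<close>, which is the skewness of \<open>P\<close>.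
\<close>

lemma quadratic_Rota_Baxter_of_factorizable:
  fixes scl :: "'k::field \<Rightarrow> 'a::ab_group_add \<Rightarrow> 'a"
  assumes fd: "finite_dimensional_vector_space scl Basis" and lam: "lam \<noteq> 0"
    and fac: "factorizable scl ast circ r"
  defines "\<omega> \<equiv> \<lambda>x y. - lam * inv_into (dual scl) (T_op scl (r + flip r)) x y"
  shows "quadratic_Rota_Baxter_APP scl lam ast circ (\<lambda>x. T_op scl r (sharp \<omega> x)) \<omega>"
proof -
  interpret finite_dual scl Basis using fd by (simp add: finite_dual_def)
  define t where "t = r + flip r"
  let ?T = "T_op scl t"
  have r: "r \<in> tensor_square scl"
    and app: "anti_pre_Poisson scl ast circ"
    and YBE: "solves_APP_YBE scl ast circ r"
    and inv: "tensor_invariant scl ast circ t"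
    and T: "dual_linear_iso scl ?T"
    using fac by (simp_all add: t_def factorizable_def quasi_triangular_def anti_pre_Poisson_bialgebra_def)
  obtain n a b where r_eq: "r = tensor_sum scl n a b" using r by (auto simp: tensor_square_def)
  have t_T: "t \<zeta> \<eta> = \<eta> (?T \<zeta>)" if "\<zeta> \<in> dual scl" "\<eta> \<in> dual scl" for \<zeta> \<eta>
  proof -
    have at: "t \<zeta> \<eta> = \<eta> ((\<Sum>i<n. scl (\<zeta> (a i)) (b i)) + (\<Sum>i<n. scl (\<zeta> (b i)) (a i)))"
      if "\<eta> \<in> dual scl" for \<eta>
      using that \<open>\<zeta> \<in> dual scl\<close>
      by (simp add: t_def r_eq flip_def tensor_sum_apply dual_simps mult.commute)
    then have "?T \<zeta> = (\<Sum>i<n. scl (\<zeta> (a i)) (b i)) + (\<Sum>i<n. scl (\<zeta> (b i)) (a i))"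
      by (rule T_op_eqI)
    with at[OF that(2)] show ?thesis by simp
  qed
  have t_sym: "t \<zeta> \<eta> = t \<eta> \<zeta>" for \<zeta> \<eta> by (simp add: t_def flip_def add.commute)
  have T_bij: "bij_betw ?T (dual scl) UNIV" using T by (simp add: dual_linear_iso_def)
  define S where "S = inv_into (dual scl) ?T"
  have S: "S x \<in> dual scl" "?T (S x) = x" for x
    using T_bij inv_into_into[of x ?T "dual scl"] f_inv_into_f[of x ?T "dual scl"]
    by (simp_all add: S_def bij_betw_def)
  have S_T: "S (?T \<zeta>) = \<zeta>" if "\<zeta> \<in> dual scl" for \<zeta>
    using T_bij that by (simp add: S_def bij_betw_def)
  have \<omega>: "\<omega> x y = - lam * S x y" for x y by (simp add: \<omega>_def S_def t_def)
  have S_sym: "S x y = S y x" for x y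
    using t_T[OF S(1)[of x] S(1)[of y]] t_T[OF S(1)[of y] S(1)[of x]] t_sym[of "S x" "S y"]
    by (simp add: S(2))
  have \<omega>_sym: "\<omega> x y = \<omega> y x" for x y by (simp only: \<omega> S_sym)
  have form: "bilinear_form scl \<omega>"
    unfolding bilinear_form_iff[OF vector_space_axioms] \<omega>
    by (simp add: S_sym[of _ z for z] dual_simps[OF S(1)] algebra_simps)
  have "nondegenerate \<omega>"
  proof -
    have "x = 0" if "\<And>y. \<omega> x y = 0" for x
    proof (rule dual_separates)
      fix \<zeta> assume "\<zeta> \<in> dual scl"
      then show "\<zeta> x = \<zeta> 0" using that[of "?T \<zeta>"] lam S_T
        by (simp add: \<omega> S_sym[of x] dual_simps)
    qed
    then show ?thesis unfolding nondegenerate_def by (metis \<omega> S_sym)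
  qed
  have inv': "t \<zeta> (\<eta> \<circ> Lstar ast x) = - t (\<zeta> \<circ> Lop ast x) \<eta>"
    "t (\<zeta> \<circ> Lop circ x) \<eta> = t \<zeta> (\<eta> \<circ> adop circ x)"
    if "\<zeta> \<in> dual scl" "\<eta> \<in> dual scl" for \<zeta> \<eta> x
  proof -
    have "tmap scl id (Lstar ast x) t + tmap scl (Lop ast x) id t = 0"
      "tmap scl (Lop circ x) id t - tmap scl id (adop circ x) t = 0"
      using inv unfolding tensor_invariant_def by blast+
    from this[THEN fun_cong, THEN fun_cong, of \<zeta> \<eta>] that
    show "t \<zeta> (\<eta> \<circ> Lstar ast x) = - t (\<zeta> \<circ> Lop ast x) \<eta>"
      "t (\<zeta> \<circ> Lop circ x) \<eta> = t \<zeta> (\<eta> \<circ> adop circ x)"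
      by (simp_all add: tmap_def eq_neg_iff_add_eq_0)
  qed
  have op: "bilinear_op_on scl UNIV ast" "bilinear_op_on scl UNIV circ"
    using app by (simp_all add: anti_pre_Poisson_on_def anti_Zinbiel_on_def anti_pre_Lie_on_def)
  note op_simps = bilinear_op_simps[OF op(1)] bilinear_op_simps[OF op(2)]
  have lin: "lin (Lop ast x)" "lin (Lop circ x)" "lin (Lstar ast x)" "lin (adop circ x)" for x
    by (simp_all add: lin_iff Lop_def Rop_def Lstar_def adop_def op_simps algebra_simps)
  have \<omega>_t: "\<omega> (f y) z = - lam * t (S z \<circ> f) (S y)" "\<omega> y (f z) = - lam * t (S z) (S y \<circ> f)"
    if "lin f" for f y z
    using t_T[OF S(1)[of y] dual_comp[OF that S(1)[of z]]] t_sym[of "S y" "S z \<circ> f"]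
      t_T[OF S(1)[of z] dual_comp[OF that S(1)[of y]]]
    by (simp_all add: \<omega> S(2) S_sym[of _ z])
  have inv_ast: "\<omega> (ast x y) z = - \<omega> y (star ast x z)" for x y z
    using \<omega>_t(1)[OF lin(1)[of x], of y z] \<omega>_t(2)[OF lin(3)[of x], of y z] inv'(1)[OF S(1)[of z] S(1)[of y]]
    by (simp add: Lop_def Lstar_def Rop_def star_def)
  have inv_circ: "\<omega> (circ x y) z = \<omega> y (bracket circ x z)" for x y z
    using \<omega>_t(1)[OF lin(2)[of x], of y z] \<omega>_t(2)[OF lin(4)[of x], of y z] inv'(2)[OF S(1)[of z] S(1)[of y]]
    by (simp add: Lop_def adop_def Rop_def bracket_def)
  interpret Q: quadratic_APP scl Basis \<omega> ast circ
    by unfold_locales (fact form \<open>nondegenerate \<omega>\<close> app inv_ast inv_circ \<omega>_sym)+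
  define P where "P x = T_op scl r (sharp \<omega> x)" for x
  have r_P: "r = Q.op_tensor P" unfolding P_def[abs_def] by (rule Q.op_tensor_T_op[OF r])
  interpret R: quadratic_APP_skew scl Basis \<omega> ast circ lam P
  proof (intro quadratic_APP_skew.intro quadratic_APP_skew_axioms.intro Q.quadratic_APP_axioms)
    show "lin P" unfolding P_def[abs_def] by (rule Q.lin_T_op_sharp[OF r])
    fix x y
    have "\<omega> (P x) y + \<omega> x (P y) = t (sharp \<omega> x) (sharp \<omega> y)"
      by (simp add: t_def flip_def) (simp add: r_P Q.op_tensor_sharp Q.form_sym[of y])
    also have "\<dots> = sharp \<omega> y (?T (sharp \<omega> x))" by (simp add: t_T Q.sharp_in_dual)
    also have "sharp \<omega> x = fun_scale (- lam) (S x)" by (simp add: fun_eq_iff sharp_def \<omega> fun_scale_def)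
    also have "?T \<dots> = scl (- lam) x" using T S by (simp add: dual_linear_iso_def)
    finally show "\<omega> (P x) y + \<omega> x (P y) + lam * \<omega> x y = 0"
      by (simp add: sharp_def Q.form_simps Q.form_sym[of y])
  qed
  show ?thesis
    using YBE R.skew R.lin_P R.solves_APP_YBE_iff
    unfolding r_P[symmetric] P_def[symmetric] quadratic_Rota_Baxter_APP_def quadratic_anti_pre_Poisson_def
    using app form Q.nondeg Q.form_sym inv_ast inv_circ by blast
qed

theorem theorem5p15:
  fixes scl :: "'k::field \<Rightarrow> 'a::ab_group_add \<Rightarrow> 'a" and Basis :: "'a set"
    and ast circ :: "'a \<Rightarrow> 'a \<Rightarrow> 'a" and lam :: 'k
  assumes "finite_dimensional_vector_space scl Basis"
    and "lam \<noteq> 0"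
  shows
    "(\<forall>r. factorizable scl ast circ r \<longrightarrow>
        (let \<omega> = (\<lambda>x y. - lam * inv_into (dual scl) (T_op scl (r + flip r)) x y);
             P = (\<lambda>x. T_op scl r (sharp \<omega> x))
         in quadratic_Rota_Baxter_APP scl lam ast circ P \<omega>)) \<and>
     (\<forall>P \<omega>. quadratic_Rota_Baxter_APP scl lam ast circ P \<omega> \<longrightarrow>
        (\<exists>r\<in>tensor_square scl.
           (\<forall>\<zeta>\<in>dual scl. T_op scl r \<zeta> = P (inv_into UNIV (sharp \<omega>) \<zeta>)) \<and>
           factorizable scl ast circ r))"
proof (intro conjI allI impI)
  fix r assume "factorizable scl ast circ r"
  then show "let \<omega> = (\<lambda>x y. - lam * inv_into (dual scl) (T_op scl (r + flip r)) x y);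
             P = (\<lambda>x. T_op scl r (sharp \<omega> x))
         in quadratic_Rota_Baxter_APP scl lam ast circ P \<omega>"
    unfolding Let_def by (rule quadratic_Rota_Baxter_of_factorizable[OF assms])
next
  fix P \<omega> assume Q: "quadratic_Rota_Baxter_APP scl lam ast circ P \<omega>"
  interpret finite_dimensional_vector_space scl Basis by (rule assms)
  interpret quadratic_APP_skew scl Basis \<omega> ast circ lam P
    using Q unfolding quadratic_Rota_Baxter_APP_def quadratic_anti_pre_Poisson_def
    by (intro quadratic_APP_skew.intro quadratic_APP_skew_axioms.intro quadratic_APP.intro
        quadratic_APP_axioms.intro symmetric_form.intro symmetric_form_axioms.intro
        finite_dual.intro assms(1)) blast+
  have "factorizable scl ast circ (op_tensor P)"
    using Q assms(2) by (intro factorizable_r) (simp_all add: quadratic_Rota_Baxter_APP_def)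
  then show "\<exists>r\<in>tensor_square scl.
      (\<forall>\<zeta>\<in>dual scl. T_op scl r \<zeta> = P (inv_into UNIV (sharp \<omega>) \<zeta>)) \<and> factorizable scl ast circ r"
    by (intro bexI[where x = "op_tensor P"] conjI ballI)
      (simp_all add: T_op_op_tensor flat_def r_in_tensor_square)
qed

end
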